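(* Let $\mathcal H$ be a Hilbert space with two inner products $(\cdot,\cdot)_0$ and $(\cdot,\cdot)_1$, and let $H_0,H_1$ be densely defined nonnegative operators on $\mathcal H$, self-adjoint with respect to $(\cdot,\cdot)_0$ and $(\cdot,\cdot)_1$ respectively, such that some dense subspace $\mathcal C\subset\mathcal H$ is contained in $\mathrm{Dom}(H_0)\cap\mathrm{Dom}(H_1)$. Suppose that $H_0,H_1$ are $\varepsilon$-close for some $0<\varepsilon<1/2$. Fix $A>0$. Then for any $\lambda\in\sigma(H_1)\cap[0,A]$, \[ \mathrm{dist}(\lambda,\sigma(H_0))<c(A)\,\varepsilon^{1/3} \] for a constant $c(A)$ depending only on $A$. In particular, \[ d_{GH}(\sigma(H_0),\sigma(H_1))=o(1), \] where $o(1)\to0$ as $\varepsilon\to0$.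
   Context: Let $\|\cdot\|_i$ be the norm of $(\cdot,\cdot)_i$ and $Q_i$ the quadratic form of $H_i$, $i=0,1$. The operators $H_0,H_1$ are $\varepsilon$-close ($0<\varepsilon<1$) if for all $u\in\mathcal C$ \[ (1-\varepsilon)\|u\|_0^2\le\|u\|_1^2\le(1+\varepsilon)\|u\|_0^2,\qquad (1-\varepsilon)Q_0(u,u)\le Q_1(u,u)\le(1+\varepsilon)Q_0(u,u). \] In expressions with $d_{GH}$, a spectrum $\sigma\subset[0,\infty)$ is regarded as the pointed complete metric space $(\{-1\}\cup\sigma,-1)$ with the metric induced from $\mathbb R$, and $d_{GH}$ is the pointed Gromov–Hausdorff distance.
   Formalization: The dense subspace C is additionally assumed to be a form core of both H_0 and H_1 (dense in each form norm); with norm density alone the claim fails, e.g. Dirichlet versus Neumann Laplacian on (0,1) with C = C_c^∞(0,1). *)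

theory Defs
  imports "HOL-Analysis.Analysis"
begin

text \<open>
  A Hilbert space is a linear subspace \<open>V\<close> of a complex vector space (type \<open>'a\<close>, scalar
  multiplication \<open>smul\<close>) together with an inner product \<open>ip\<close> on \<open>V\<close>.  Nothing is assumed about
  \<open>ip\<close> outside \<open>V\<close>.  Carrier sets are used so that one constant can serve for all Hilbert spaces
  inside \<open>'a\<close>, and because the same \<open>V\<close> carries two inner products.
\<close>

definition ip_norm :: "('a \<Rightarrow> 'a \<Rightarrow> complex) \<Rightarrow> 'a \<Rightarrow> real" where
  "ip_norm ip u = sqrt (Re (ip u u))"

locale hilbert_space_on = vector_space smul
  for smul :: "complex \<Rightarrow> 'a \<Rightarrow> 'a::ab_group_add" +
  fixes V :: "'a set" and ip :: "'a \<Rightarrow> 'a \<Rightarrow> complex"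
  assumes subspace_V: "subspace V"
    and ip_add: "\<lbrakk>u \<in> V; v \<in> V; w \<in> V\<rbrakk> \<Longrightarrow> ip (u + v) w = ip u w + ip v w"
    and ip_scale: "\<lbrakk>u \<in> V; w \<in> V\<rbrakk> \<Longrightarrow> ip (smul a u) w = a * ip u w"
    and ip_commute: "\<lbrakk>u \<in> V; v \<in> V\<rbrakk> \<Longrightarrow> ip v u = cnj (ip u v)"
    and ip_pos: "\<lbrakk>u \<in> V; u \<noteq> 0\<rbrakk> \<Longrightarrow> 0 < Re (ip u u)"
    and complete_V:
      "\<lbrakk>\<And>n. X n \<in> V; \<And>e. 0 < e \<Longrightarrow> \<exists>N. \<forall>m\<ge>N. \<forall>n\<ge>N. ip_norm ip (X m - X n) < e\<rbrakk>
       \<Longrightarrow> \<exists>l\<in>V. (\<lambda>n. ip_norm ip (X n - l)) \<longlonglongrightarrow> 0"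

definition dense_in :: "('a::ab_group_add) set \<Rightarrow> ('a \<Rightarrow> 'a \<Rightarrow> complex) \<Rightarrow> 'a set \<Rightarrow> bool" where
  "dense_in V ip C \<longleftrightarrow> C \<subseteq> V \<and> (\<forall>u\<in>V. \<forall>\<delta>>0. \<exists>v\<in>C. ip_norm ip (u - v) < \<delta>)"

text \<open>Unbounded operators; the value of \<open>app T\<close> outside \<open>Dom T\<close> is irrelevant.\<close>

record 'a unbounded_operator =
  Dom :: "'a set"
  app :: "'a \<Rightarrow> 'a"

definition linear_operator ::
    "(complex \<Rightarrow> 'a \<Rightarrow> 'a::ab_group_add) \<Rightarrow> 'a set \<Rightarrow> 'a unbounded_operator \<Rightarrow> bool" where
  "linear_operator smul V T \<longleftrightarrow>
     Dom T \<subseteq> V \<and> module.subspace smul (Dom T) \<and> app T ` Dom T \<subseteq> V \<and>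
     (\<forall>u\<in>Dom T. \<forall>v\<in>Dom T. app T (u + v) = app T u + app T v) \<and>
     (\<forall>a. \<forall>u\<in>Dom T. app T (smul a u) = smul a (app T u))"

definition op_graph :: "'a unbounded_operator \<Rightarrow> ('a \<times> 'a) set" where
  "op_graph T = {(u, app T u) | u. u \<in> Dom T}"

definition adjoint_graph ::
    "'a set \<Rightarrow> ('a \<Rightarrow> 'a \<Rightarrow> complex) \<Rightarrow> 'a unbounded_operator \<Rightarrow> ('a \<times> 'a) set" where
  "adjoint_graph V ip T = {(v, w) \<in> V \<times> V. \<forall>u\<in>Dom T. ip (app T u) v = ip u w}"

definition self_adjoint ::
    "'a set \<Rightarrow> ('a::ab_group_add \<Rightarrow> 'a \<Rightarrow> complex) \<Rightarrow> 'a unbounded_operator \<Rightarrow> bool" where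
  "self_adjoint V ip T \<longleftrightarrow> dense_in V ip (Dom T) \<and> adjoint_graph V ip T = op_graph T"

text \<open>
  The diagonal \<open>Q(u,u)\<close> of the quadratic form of a nonnegative self-adjoint operator, for \<open>u\<close> in
  the operator domain.  There \<open>Q(u,u) = (Tu,u)\<close>, which is automatically real.
\<close>

definition quad_form ::
    "('a \<Rightarrow> 'a \<Rightarrow> complex) \<Rightarrow> 'a unbounded_operator \<Rightarrow> 'a \<Rightarrow> real" where
  "quad_form ip T u = Re (ip (app T u) u)"

definition nonnegative ::
    "('a \<Rightarrow> 'a \<Rightarrow> complex) \<Rightarrow> 'a unbounded_operator \<Rightarrow> bool" where
  "nonnegative ip T \<longleftrightarrow> (\<forall>u\<in>Dom T. 0 \<le> quad_form ip T u)"

text \<open>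
  \<open>C\<close> is a form core: it is dense in the form domain for the form norm
  \<open>(\<parallel>u\<parallel>\<^sup>2 + Q(u,u))\<^sup>1\<^sup>/\<^sup>2\<close>.  As the operator domain is itself always a form core, it suffices
  to approximate its elements.  Density of \<open>C\<close> in the Hilbert space alone does not let \<open>C\<close>
  determine the operator: the Dirichlet and Neumann Laplacians on an interval have the same form on
  the compactly supported smooth functions, but different spectra.
\<close>

definition form_core ::
    "('a::ab_group_add \<Rightarrow> 'a \<Rightarrow> complex) \<Rightarrow> 'a unbounded_operator \<Rightarrow> 'a set \<Rightarrow> bool" where
  "form_core ip T C \<longleftrightarrow> C \<subseteq> Dom T \<and>
     (\<forall>u\<in>Dom T. \<forall>\<delta>>0. \<exists>v\<in>C. (ip_norm ip (u - v))\<^sup>2 + quad_form ip T (u - v) < \<delta>)"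

definition resolvent_set ::
    "(complex \<Rightarrow> 'a \<Rightarrow> 'a::ab_group_add) \<Rightarrow> 'a set \<Rightarrow> ('a \<Rightarrow> 'a \<Rightarrow> complex)
       \<Rightarrow> 'a unbounded_operator \<Rightarrow> complex set" where
  "resolvent_set smul V ip T =
     {z. bij_betw (\<lambda>u. app T u - smul z u) (Dom T) V \<and>
         (\<exists>M. \<forall>u\<in>Dom T. ip_norm ip u \<le> M * ip_norm ip (app T u - smul z u))}"

definition spectrum ::
    "(complex \<Rightarrow> 'a \<Rightarrow> 'a::ab_group_add) \<Rightarrow> 'a set \<Rightarrow> ('a \<Rightarrow> 'a \<Rightarrow> complex)
       \<Rightarrow> 'a unbounded_operator \<Rightarrow> complex set" where
  "spectrum smul V ip T = - resolvent_set smul V ip T"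

text \<open>
  The spectrum as a set of reals.  For nonnegative self-adjoint operators the spectrum is contained
  in \<open>[0,\<infinity>)\<close>, so no point is lost.
\<close>

definition real_spectrum ::
    "(complex \<Rightarrow> 'a \<Rightarrow> 'a::ab_group_add) \<Rightarrow> 'a set \<Rightarrow> ('a \<Rightarrow> 'a \<Rightarrow> complex)
       \<Rightarrow> 'a unbounded_operator \<Rightarrow> real set" where
  "real_spectrum smul V ip T = {x. complex_of_real x \<in> spectrum smul V ip T}"

text \<open>
  The completeness of \<open>V\<close> and the density of \<open>C\<close> are required for each of the two inner products;
  equivalence of the two norms is not assumed.
\<close>

definition operator_pair ::
    "(complex \<Rightarrow> 'a \<Rightarrow> 'a::ab_group_add) \<Rightarrow> 'a set
       \<Rightarrow> ('a \<Rightarrow> 'a \<Rightarrow> complex) \<Rightarrow> ('a \<Rightarrow> 'a \<Rightarrow> complex)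
       \<Rightarrow> 'a unbounded_operator \<Rightarrow> 'a unbounded_operator \<Rightarrow> 'a set \<Rightarrow> bool" where
  "operator_pair smul V ip0 ip1 H0 H1 C \<longleftrightarrow>
     hilbert_space_on smul V ip0 \<and> hilbert_space_on smul V ip1 \<and>
     linear_operator smul V H0 \<and> self_adjoint V ip0 H0 \<and> nonnegative ip0 H0 \<and>
     linear_operator smul V H1 \<and> self_adjoint V ip1 H1 \<and> nonnegative ip1 H1 \<and>
     module.subspace smul C \<and> C \<subseteq> Dom H0 \<inter> Dom H1 \<and>
     dense_in V ip0 C \<and> dense_in V ip1 C"

definition eps_close ::
    "('a \<Rightarrow> 'a \<Rightarrow> complex) \<Rightarrow> ('a \<Rightarrow> 'a \<Rightarrow> complex)
       \<Rightarrow> 'a unbounded_operator \<Rightarrow> 'a unbounded_operator \<Rightarrow> 'a set \<Rightarrow> real \<Rightarrow> bool" where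
  "eps_close ip0 ip1 H0 H1 C \<epsilon> \<longleftrightarrow> 0 < \<epsilon> \<and> \<epsilon> < 1 \<and>
     (\<forall>u\<in>C. (1 - \<epsilon>) * (ip_norm ip0 u)\<^sup>2 \<le> (ip_norm ip1 u)\<^sup>2 \<and>
             (ip_norm ip1 u)\<^sup>2 \<le> (1 + \<epsilon>) * (ip_norm ip0 u)\<^sup>2 \<and>
             (1 - \<epsilon>) * quad_form ip0 H0 u \<le> quad_form ip1 H1 u \<and>
             quad_form ip1 H1 u \<le> (1 + \<epsilon>) * quad_form ip0 H0 u)"

text \<open>
  Gromov's distance between pointed metric spaces: the infimum of all \<open>r > 0\<close> for which some metric
  on the disjoint union extends the two given ones, puts the base points at distance less than \<open>r\<close>,
  and puts the ball of radius \<open>1/r\<close> about either base point into the \<open>r\<close>-neighbourhood of the other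
  space.  Every \<open>r > 1\<close> is admissible (glue at distance close to 0 between the base points), so the
  infimum is over a nonempty set.
\<close>

definition pointed_GH_dist ::
    "'a::metric_space set \<times> 'a \<Rightarrow> 'b::metric_space set \<times> 'b \<Rightarrow> real" where
  "pointed_GH_dist = (\<lambda>(X, p) (Y, q). Inf {r. 0 < r \<and>
     (\<exists>d. Metric_space (X <+> Y) d \<and>
        (\<forall>x\<in>X. \<forall>x'\<in>X. d (Inl x) (Inl x') = dist x x') \<and>
        (\<forall>y\<in>Y. \<forall>y'\<in>Y. d (Inr y) (Inr y') = dist y y') \<and>
        d (Inl p) (Inr q) < r \<and>
        (\<forall>x\<in>X. dist p x < 1 / r \<longrightarrow> (\<exists>y\<in>Y. d (Inl x) (Inr y) < r)) \<and>
        (\<forall>y\<in>Y. dist q y < 1 / r \<longrightarrow> (\<exists>x\<in>X. d (Inl x) (Inr y) < r)))})"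

definition pointed_spectrum :: "real set \<Rightarrow> real set \<times> real" where
  "pointed_spectrum \<sigma> = ({-1} \<union> \<sigma>, -1)"

end

theory Submission
  imports Defs
begin

text \<open>
  The spectra are compared by testing approximate eigenvectors in the weak form of the eigenvalue
  equation, and this gives more than the stated exponent: the distance is \<open>O(\<epsilon>)\<close>.

  Let \<open>\<alpha>\<close> be in the spectrum of \<open>H\<^sub>1\<close>, and write \<open>\<parallel>w\<parallel>\<^sub>E\<close> for the energy norm
  \<open>(\<parallel>w\<parallel>\<^sup>2 + Q(w,w))\<^sup>1\<^sup>/\<^sup>2\<close>. Since \<open>H\<^sub>1\<close> is self-adjoint, \<open>\<alpha>\<close> has approximate eigenvectors,
  and since \<open>C\<close> is a form core, one of them can be replaced by some \<open>v \<in> C\<close> that still satisfies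
  \<open>|Q\<^sub>1(v,w) - \<alpha> (v,w)\<^sub>1| \<le> \<delta> \<parallel>w\<parallel>\<^sub>E\<close> for all \<open>w\<close>, with \<open>\<delta>\<close> as small as desired
  (\<open>approx_eigenvector_in_core\<close>). On \<open>C\<close> the Hermitian form
  \<open>(Q\<^sub>1 - \<alpha> (\<cdot>,\<cdot>)\<^sub>1) - (Q\<^sub>0 - \<alpha> (\<cdot>,\<cdot>)\<^sub>0)\<close> is bounded on the diagonal by \<open>\<epsilon> (1 + \<alpha>)\<close> times the
  energy of \<open>H\<^sub>0\<close>, hence off the diagonal by twice this constant (\<open>hermitian_form_bound\<close>).
  Together, \<open>|((H\<^sub>0 - \<alpha>) v, w)\<^sub>0| \<le> const \<cdot> \<epsilon> \<parallel>w\<parallel>\<^sub>E\<close> for \<open>w \<in> C\<close>; since \<open>v\<close> lies in the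
  domain of \<open>H\<^sub>0\<close> and \<open>C\<close> is a form core, this extends to all \<open>w\<close> in that domain.

  Suppose that \<open>H\<^sub>0\<close> had no spectrum in \<open>[\<alpha> - r, \<alpha> + r]\<close>. Then \<open>\<parallel>(H\<^sub>0 - \<alpha>)\<^sup>-\<^sup>1\<parallel> \<le> 1/r\<close>
  (\<open>spectral_gap_bounds_shifted\<close>). The choice \<open>w = (H\<^sub>0 - \<alpha>)\<^sup>-\<^sup>1 v\<close> turns the left-hand side into
  \<open>\<parallel>v\<parallel>\<^sub>0\<^sup>2\<close>, while the energy of \<open>w\<close> is controlled by \<open>r\<close>; this is impossible once \<open>r\<close> is a
  sufficiently large multiple of \<open>\<epsilon>\<close> (\<open>small_form_imp_spectrum_near\<close>).

  Closeness of the operators is symmetric up to replacing \<open>\<epsilon>\<close> by \<open>2\<epsilon>\<close>, so the estimate holds in both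
  directions. Its constant grows like \<open>(1 + \<alpha>)\<^sup>4\<close>, and in a ball of radius \<open>1/r\<close> about the base
  point \<open>-1\<close> it is at most \<open>r\<^sup>-\<^sup>4\<close>; balancing this with the required accuracy \<open>r\<close> gives the bound
  \<open>const \<cdot> \<epsilon>\<^sup>1\<^sup>/\<^sup>5\<close> for the pointed Gromov-Hausdorff distance.
\<close>

section \<open>Positive semidefinite Hermitian forms\<close>

text \<open>
  Definiteness is left out so that Cauchy-Schwarz applies not only to the inner products but also to
  combinations \<open>\<kappa> f \<plusminus> b\<close> of forms, from which \<open>hermitian_form_bound\<close> is derived.
\<close>

locale psd_form = vector_space smul
  for smul :: "complex \<Rightarrow> 'a \<Rightarrow> 'a::ab_group_add" +
  fixes W :: "'a set" and f :: "'a \<Rightarrow> 'a \<Rightarrow> complex"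
  assumes subspace_W: "subspace W"
    and f_add: "\<lbrakk>u \<in> W; v \<in> W; w \<in> W\<rbrakk> \<Longrightarrow> f (u + v) w = f u w + f v w"
    and f_scale: "\<lbrakk>u \<in> W; w \<in> W\<rbrakk> \<Longrightarrow> f (smul a u) w = a * f u w"
    and f_commute: "\<lbrakk>u \<in> W; v \<in> W\<rbrakk> \<Longrightarrow> f v u = cnj (f u v)"
    and f_nonneg: "u \<in> W \<Longrightarrow> 0 \<le> Re (f u u)"
begin

lemma W_closed [simp, intro]:
  "0 \<in> W"
  "\<lbrakk>u \<in> W; v \<in> W\<rbrakk> \<Longrightarrow> u + v \<in> W"
  "\<lbrakk>u \<in> W; v \<in> W\<rbrakk> \<Longrightarrow> u - v \<in> W"
  "u \<in> W \<Longrightarrow> smul a u \<in> W"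
  using subspace_W by (auto simp: subspace_0 subspace_add subspace_diff subspace_scale)

lemma f_diff:
  assumes "u \<in> W" "v \<in> W" "w \<in> W"
  shows "f (u - v) w = f u w - f v w"
  using f_add[of "u - v" v w] assms by simp

lemma f_add_right:
  assumes "u \<in> W" "v \<in> W" "w \<in> W"
  shows "f w (u + v) = f w u + f w v"
  using assms f_add[of u v w] f_commute[of "u + v" w] f_commute[of u w] f_commute[of v w] by simp

lemma f_diff_right:
  assumes "u \<in> W" "v \<in> W" "w \<in> W"
  shows "f w (u - v) = f w u - f w v"
  using assms f_diff[of u v w] f_commute[of "u - v" w] f_commute[of u w] f_commute[of v w] by simp

lemma f_scale_right:
  assumes "u \<in> W" "w \<in> W"
  shows "f w (smul a u) = cnj a * f w u"
  using assms f_scale[of u w a] f_commute[of "smul a u" w] f_commute[of u w] by simp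

lemma f_zero [simp]:
  assumes "w \<in> W" shows "f 0 w = 0" "f w 0 = 0"
  using f_diff[of w w w] f_diff_right[of w w w] assms by auto

lemma f_self_real: "u \<in> W \<Longrightarrow> f u u = of_real (Re (f u u))"
  using f_commute[of u u] by (simp add: complex_eq_iff)

lemma nrm_nonneg: "u \<in> W \<Longrightarrow> 0 \<le> ip_norm f u"
  by (simp add: ip_norm_def f_nonneg)

lemma nrm_sq: "u \<in> W \<Longrightarrow> (ip_norm f u)\<^sup>2 = Re (f u u)"
  by (simp add: ip_norm_def f_nonneg)

lemma nrm_zero [simp]: "ip_norm f 0 = 0"
  by (simp add: ip_norm_def)

lemma nrm_sq_add:
  assumes "u \<in> W" "v \<in> W"
  shows "(ip_norm f (u + v))\<^sup>2 = (ip_norm f u)\<^sup>2 + 2 * Re (f u v) + (ip_norm f v)\<^sup>2"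
  using assms f_commute[of u v] by (simp add: nrm_sq f_add f_add_right)

lemma nrm_sq_diff:
  assumes "u \<in> W" "v \<in> W"
  shows "(ip_norm f (u - v))\<^sup>2 = (ip_norm f u)\<^sup>2 - 2 * Re (f u v) + (ip_norm f v)\<^sup>2"
  using assms f_commute[of u v] by (simp add: nrm_sq f_diff f_diff_right)

lemma nrm_scale:
  assumes "u \<in> W"
  shows "ip_norm f (smul a u) = cmod a * ip_norm f u"
proof -
  have "f (smul a u) (smul a u) = (a * cnj a) * f u u"
    using assms by (simp only: f_scale f_scale_right W_closed ac_simps)
  also have "\<dots> = of_real ((cmod a)\<^sup>2) * f u u"
    by (simp only: complex_norm_square)
  finally have "Re (f (smul a u) (smul a u)) = (cmod a)\<^sup>2 * Re (f u u)"
    by (simp only: Re_complex_of_real times_complex.sel Im_complex_of_real)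
  then show ?thesis
    by (simp add: ip_norm_def real_sqrt_mult)
qed

lemma nrm_minus_commute:
  assumes "u \<in> W" "v \<in> W"
  shows "ip_norm f (u - v) = ip_norm f (v - u)"
  using nrm_scale[of "v - u" "-1"] assms by simp

lemma cauchy_schwarz:
  assumes u: "u \<in> W" and v: "v \<in> W"
  shows "cmod (f u v) \<le> ip_norm f u * ip_norm f v"
proof (cases "f u v = 0")
  case True
  then show ?thesis using u v by (simp add: nrm_nonneg)
next
  case False
  define c where "c = f u v"
  define P where "P = (cmod c)\<^sup>2"
  define A where "A = (ip_norm f u)\<^sup>2"
  define B where "B = (ip_norm f v)\<^sup>2"
  have P: "P > 0" using False by (simp add: P_def c_def)
  \<comment> \<open>The squared norm of \<open>u - s c v\<close>, a nonnegative quadratic polynomial in \<open>s\<close>.\<close>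
  have poly: "0 \<le> A - 2 * s * P + s\<^sup>2 * P * B" for s :: real
  proof -
    have "Re (f u (smul (of_real s * c) v)) = s * P"
      using u v by (simp add: f_scale_right flip: c_def)
        (simp add: P_def cmod_power2, simp add: power2_eq_square algebra_simps)
    moreover have "(ip_norm f (smul (of_real s * c) v))\<^sup>2 = s\<^sup>2 * P * B"
      using v by (simp add: nrm_scale power_mult_distrib norm_mult P_def B_def)
    ultimately show ?thesis
      using nrm_sq_diff[of u "smul (of_real s * c) v"] u v
        zero_le_power2[of "ip_norm f (u - smul (of_real s * c) v)"]
      by (simp add: A_def)
  qed
  have "P \<le> A * B"
  proof (cases "B = 0")
    case True
    have "0 \<le> A" by (simp add: A_def)
    moreover have "0 \<le> A - 2 * (A + 1)" using poly[of "(A + 1) / P"] P True by simp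
    ultimately have False by simp
    then show ?thesis ..
  next
    case False
    then have "B > 0" by (simp add: B_def)
    then show ?thesis using poly[of "1 / B"] P by (simp add: power2_eq_square field_simps)
  qed
  then have "(cmod (f u v))\<^sup>2 \<le> (ip_norm f u * ip_norm f v)\<^sup>2"
    by (simp add: P_def A_def B_def c_def power_mult_distrib)
  then show ?thesis
    using u v by (meson mult_nonneg_nonneg nrm_nonneg power2_le_imp_le)
qed

lemma nrm_triangle:
  assumes u: "u \<in> W" and v: "v \<in> W"
  shows "ip_norm f (u + v) \<le> ip_norm f u + ip_norm f v"
proof -
  have "Re (f u v) \<le> ip_norm f u * ip_norm f v"
    using cauchy_schwarz[OF u v] complex_Re_le_cmod[of "f u v"] by linarith
  then have "(ip_norm f (u + v))\<^sup>2 \<le> (ip_norm f u + ip_norm f v)\<^sup>2"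
    unfolding nrm_sq_add[OF u v] by (simp add: power2_sum)
  then show ?thesis
    using u v by (meson add_nonneg_nonneg nrm_nonneg power2_le_imp_le)
qed

lemma nrm_triangle_diff:
  assumes u: "u \<in> W" and v: "v \<in> W"
  shows "ip_norm f u \<le> ip_norm f v + ip_norm f (u - v)"
  using nrm_triangle[of v "u - v"] u v by simp

lemma parallelogram:
  assumes u: "u \<in> W" and v: "v \<in> W"
  shows "(ip_norm f (u + v))\<^sup>2 + (ip_norm f (u - v))\<^sup>2 = 2 * (ip_norm f u)\<^sup>2 + 2 * (ip_norm f v)\<^sup>2"
  by (simp add: nrm_sq_add nrm_sq_diff u v)

lemma f_tendsto_right:
  assumes "w \<in> W" "\<And>n. X n \<in> W" "l \<in> W" "(\<lambda>n. ip_norm f (X n - l)) \<longlonglongrightarrow> 0"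
  shows "(\<lambda>n. f w (X n)) \<longlonglongrightarrow> f w l"
proof -
  have "(\<lambda>n. f w (X n) - f w l) \<longlonglongrightarrow> 0"
  proof (rule Lim_null_comparison)
    show "\<forall>\<^sub>F n in sequentially. norm (f w (X n) - f w l) \<le> ip_norm f w * ip_norm f (X n - l)"
      using cauchy_schwarz[of w "X _ - l"] assms by (simp add: f_diff_right)
    show "(\<lambda>n. ip_norm f w * ip_norm f (X n - l)) \<longlonglongrightarrow> 0"
      using tendsto_mult_right_zero[OF assms(4)] by simp
  qed
  then show ?thesis by (simp add: LIM_zero_iff)
qed

lemma psd_form_subspace:
  assumes "subspace C" "C \<subseteq> W"
  shows "psd_form smul C f"
proof
  show "f v u = cnj (f u v)" if "u \<in> C" "v \<in> C" for u v
    by (rule f_commute) (use that assms in auto)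
qed (use assms in \<open>auto simp: subset_iff intro: f_add f_scale f_nonneg\<close>)

text \<open>
  Both \<open>\<kappa> f + b\<close> and \<open>\<kappa> f - b\<close> are positive semidefinite and at most \<open>2 \<kappa> f\<close> on the diagonal, and
  \<open>2 b\<close> is their difference; the factor 2 comes from applying Cauchy-Schwarz to each of them.
\<close>

lemma hermitian_form_bound:
  assumes b_add: "\<And>u v w. \<lbrakk>u \<in> W; v \<in> W; w \<in> W\<rbrakk> \<Longrightarrow> b (u + v) w = b u w + b v w"
    and b_scale: "\<And>a u w. \<lbrakk>u \<in> W; w \<in> W\<rbrakk> \<Longrightarrow> b (smul a u) w = a * b u w"
    and b_commute: "\<And>u v. \<lbrakk>u \<in> W; v \<in> W\<rbrakk> \<Longrightarrow> b v u = cnj (b u v)"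
    and bound: "\<And>u. u \<in> W \<Longrightarrow> \<bar>Re (b u u)\<bar> \<le> \<kappa> * Re (f u u)"
    and uv: "u \<in> W" "v \<in> W"
  shows "cmod (b u v) \<le> 2 * \<kappa> * ip_norm f u * ip_norm f v"
proof -
  define p where "p = (\<lambda>u v. of_real \<kappa> * f u v + b u v)"
  define m where "m = (\<lambda>u v. of_real \<kappa> * f u v - b u v)"
  interpret P: psd_form smul W p
  proof
    show "p v u = cnj (p u v)" if "u \<in> W" "v \<in> W" for u v
      using f_commute[OF that] b_commute[OF that] by (simp add: p_def)
    show "0 \<le> Re (p u u)" if "u \<in> W" for u
      using bound[OF that] by (simp add: p_def)
  qed (simp_all add: p_def f_add b_add f_scale b_scale subspace_W algebra_simps)
  interpret M: psd_form smul W m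
  proof
    show "m v u = cnj (m u v)" if "u \<in> W" "v \<in> W" for u v
      using f_commute[OF that] b_commute[OF that] by (simp add: m_def)
    show "0 \<le> Re (m u u)" if "u \<in> W" for u
      using bound[OF that] by (simp add: m_def)
  qed (simp_all add: m_def f_add b_add f_scale b_scale subspace_W algebra_simps)
  have nrm_le: "ip_norm p w \<le> sqrt (2 * \<kappa>) * ip_norm f w" "ip_norm m w \<le> sqrt (2 * \<kappa>) * ip_norm f w"
    if "w \<in> W" for w
    using bound[OF that] by (auto simp: ip_norm_def p_def m_def simp flip: real_sqrt_mult)
  have "0 \<le> \<kappa> \<or> Re (f u u) = 0"
    using bound[OF uv(1)] f_nonneg[OF uv(1)] by (smt (verit) mult_neg_pos)
  then have \<kappa>: "sqrt (2 * \<kappa>) * ip_norm f u * (sqrt (2 * \<kappa>) * ip_norm f v) = 2 * \<kappa> * ip_norm f u * ip_norm f v"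
    by (auto simp: ip_norm_def)
  have pos: "0 \<le> sqrt (2 * \<kappa>) * ip_norm f u"
    using nrm_le[OF uv(1)] P.nrm_nonneg[OF uv(1)] by linarith
  have "cmod (p u v) \<le> 2 * \<kappa> * ip_norm f u * ip_norm f v"
    unfolding \<kappa>[symmetric]
    by (rule order_trans[OF P.cauchy_schwarz mult_mono]) (use uv nrm_le pos P.nrm_nonneg in auto)
  moreover have "cmod (m u v) \<le> 2 * \<kappa> * ip_norm f u * ip_norm f v"
    unfolding \<kappa>[symmetric]
    by (rule order_trans[OF M.cauchy_schwarz mult_mono]) (use uv nrm_le pos M.nrm_nonneg in auto)
  moreover have "2 * b u v = p u v - m u v" by (simp add: p_def m_def)
  then have "2 * cmod (b u v) \<le> cmod (p u v) + cmod (m u v)"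
    by (metis norm_mult norm_numeral norm_triangle_ineq4)
  ultimately show ?thesis by linarith
qed

end

section \<open>Vectors orthogonal to a complete subspace\<close>

sublocale hilbert_space_on \<subseteq> psd_form smul V ip
proof
  show "0 \<le> Re (ip u u)" if "u \<in> V" for u
  proof (cases "u = 0")
    case True
    have "ip (smul 0 u) u = 0" using that by (subst ip_scale) auto
    then show ?thesis using True by simp
  qed (use ip_pos that in force)
qed (fact subspace_V ip_add ip_scale ip_commute)+

context hilbert_space_on
begin

lemma nrm_eq_0: "\<lbrakk>u \<in> V; ip_norm ip u = 0\<rbrakk> \<Longrightarrow> u = 0"
  using ip_pos[of u] by (force simp: ip_norm_def)

lemma nrm_pos: "\<lbrakk>u \<in> V; u \<noteq> 0\<rbrakk> \<Longrightarrow> 0 < ip_norm ip u"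
  using ip_pos[of u] by (simp add: ip_norm_def)

text \<open>
  The orthogonal vector is \<open>x - l\<close> with \<open>l\<close> the point of \<open>R\<close> nearest to \<open>x\<close>. By the parallelogram
  law a sequence in \<open>R\<close> whose distances to \<open>x\<close> tend to the infimum is Cauchy, which gives \<open>l\<close>.
\<close>

lemma orthogonal_vector_exists:
  assumes R: "subspace R" "R \<subseteq> V"
    and complete_R: "\<And>X. \<lbrakk>\<And>n. X n \<in> R; \<And>e. 0 < e \<Longrightarrow> \<exists>N. \<forall>m\<ge>N. \<forall>n\<ge>N. ip_norm ip (X m - X n) < e\<rbrakk>
        \<Longrightarrow> \<exists>l\<in>R. (\<lambda>n. ip_norm ip (X n - l)) \<longlonglongrightarrow> 0"
    and x: "x \<in> V" "x \<notin> R"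
  obtains y where "y \<in> V" "y \<noteq> 0" "\<And>r. r \<in> R \<Longrightarrow> ip r y = 0"
proof -
  define S where "S = (\<lambda>r. (ip_norm ip (x - r))\<^sup>2) ` R"
  define d where "d = Inf S"
  have bdd: "bdd_below S" unfolding S_def by (intro bdd_belowI[of _ 0]) auto
  have ne: "S \<noteq> {}" using subspace_0[OF R(1)] by (auto simp: S_def)
  have d_le: "d \<le> (ip_norm ip (x - r))\<^sup>2" if "r \<in> R" for r
    unfolding d_def using that by (intro cInf_lower bdd) (auto simp: S_def)
  have "\<exists>r\<in>R. (ip_norm ip (x - r))\<^sup>2 < d + 1 / real (Suc n)" for n
  proof -
    have "Inf S < d + 1 / real (Suc n)" by (simp add: d_def)
    then show ?thesis using cInf_lessD[OF ne] by (auto simp: S_def)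
  qed
  then obtain X where X: "\<And>n. X n \<in> R" "\<And>n. (ip_norm ip (x - X n))\<^sup>2 < d + 1 / real (Suc n)"
    by metis
  have XV: "X n \<in> V" for n using X R by auto
  have close: "(ip_norm ip (X m - X n))\<^sup>2 < 2 / real (Suc m) + 2 / real (Suc n)" for m n
  proof -
    let ?h = "smul (1/2) (X m + X n)"
    have "smul 2 (x - ?h) = (x - X n) + (x - X m)"
    proof -
      have "smul 2 x = smul 1 x + smul 1 x"
        using scale_left_distrib[of 1 1 x] by simp
      then show ?thesis by (simp add: scale_right_diff_distrib)
    qed
    then have "(ip_norm ip ((x - X n) + (x - X m)))\<^sup>2 = 4 * (ip_norm ip (x - ?h))\<^sup>2"
      using nrm_scale[of "x - ?h" 2] XV x by (simp add: power_mult_distrib)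
    moreover have "d \<le> (ip_norm ip (x - ?h))\<^sup>2"
      using X R by (intro d_le subspace_scale subspace_add) auto
    moreover have "(x - X n) - (x - X m) = X m - X n" by simp
    ultimately have "4 * d + (ip_norm ip (X m - X n))\<^sup>2
        \<le> 2 * (ip_norm ip (x - X n))\<^sup>2 + 2 * (ip_norm ip (x - X m))\<^sup>2"
      using parallelogram[of "x - X n" "x - X m"] XV x by simp
    with X(2)[of m] X(2)[of n] show ?thesis by linarith
  qed
  have "\<exists>l\<in>R. (\<lambda>n. ip_norm ip (X n - l)) \<longlonglongrightarrow> 0"
  proof (rule complete_R[OF X(1)])
    fix e :: real assume e: "0 < e"
    then obtain N where N: "1 / real (Suc N) < e\<^sup>2 / 4"
      using nat_approx_posE[of "e\<^sup>2 / 4"] by auto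
    show "\<exists>N. \<forall>m\<ge>N. \<forall>n\<ge>N. ip_norm ip (X m - X n) < e"
    proof (intro exI allI impI)
      fix m n assume mn: "N \<le> m" "N \<le> n"
      have "1 / real (Suc m) \<le> 1 / real (Suc N)" "1 / real (Suc n) \<le> 1 / real (Suc N)"
        using mn by (auto simp: frac_le)
      then have "(ip_norm ip (X m - X n))\<^sup>2 < e\<^sup>2"
        using close[of m n] N by auto
      then show "ip_norm ip (X m - X n) < e"
        using e power_less_imp_less_base by fastforce
    qed
  qed
  then obtain l where l: "l \<in> R" "(\<lambda>n. ip_norm ip (X n - l)) \<longlonglongrightarrow> 0" by blast
  have lV: "l \<in> V" using l R by auto
  have "(ip_norm ip (x - l))\<^sup>2 \<le> d"
  proof -
    have "(\<lambda>n. sqrt (d + 1 / real (Suc n)) + ip_norm ip (X n - l)) \<longlonglongrightarrow> sqrt (d + 0) + 0"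
      by (intro tendsto_intros l(2) LIMSEQ_Suc[OF lim_1_over_n])
    moreover have "ip_norm ip (x - l) \<le> sqrt (d + 1 / real (Suc n)) + ip_norm ip (X n - l)" for n
    proof -
      have "ip_norm ip (x - X n) \<le> sqrt (d + 1 / real (Suc n))"
        using X(2)[of n] by (intro real_le_rsqrt) simp
      then show ?thesis
        using nrm_triangle[of "x - X n" "X n - l"] x XV lV by simp
    qed
    ultimately have *: "ip_norm ip (x - l) \<le> sqrt d"
      by (intro LIMSEQ_le_const) auto
    have "0 \<le> d" unfolding d_def by (rule cInf_greatest[OF ne]) (auto simp: S_def)
    have "(ip_norm ip (x - l))\<^sup>2 \<le> (sqrt d)\<^sup>2"
      using * nrm_nonneg[of "x - l"] x lV by (intro power_mono) auto
    with \<open>0 \<le> d\<close> show ?thesis by simp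
  qed
  note dist_l = this
  define y where "y = x - l"
  have y: "y \<in> V" "y \<noteq> 0" using x l lV by (auto simp: y_def)
  have "ip r y = 0" if r: "r \<in> R" for r
  proof (rule ccontr)
    assume nz: "ip r y \<noteq> 0"
    have rV: "r \<in> V" using r R by auto
    define c where "c = ip y r"
    define P where "P = (cmod c)\<^sup>2"
    define B where "B = (ip_norm ip r)\<^sup>2"
    have P: "P > 0" using nz ip_commute[of r y] rV y by (simp add: P_def c_def)
    have B: "B \<ge> 0" by (simp add: B_def)
    \<comment> \<open>As \<open>l\<close> is nearest to \<open>x\<close>, moving it by \<open>s c r\<close> does not decrease the distance.\<close>
    have poly: "0 \<le> - 2 * s * P + s\<^sup>2 * P * B" for s :: real
    proof -
      have "d \<le> (ip_norm ip (x - (l + smul (of_real s * c) r)))\<^sup>2"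
        using R l r by (intro d_le subspace_add subspace_scale)
      then have "(ip_norm ip y)\<^sup>2 \<le> (ip_norm ip (y - smul (of_real s * c) r))\<^sup>2"
        using dist_l by (simp add: y_def diff_diff_eq)
      moreover have "Re (ip y (smul (of_real s * c) r)) = s * P"
        using y rV by (simp add: f_scale_right flip: c_def)
          (simp add: P_def cmod_power2, simp add: power2_eq_square algebra_simps)
      moreover have "(ip_norm ip (smul (of_real s * c) r))\<^sup>2 = s\<^sup>2 * P * B"
        using rV by (simp add: nrm_scale power_mult_distrib norm_mult P_def B_def)
      ultimately show ?thesis
        using nrm_sq_diff[of y "smul (of_real s * c) r"] y rV by simp
    qed
    \<comment> \<open>For small positive \<open>s\<close> the linear term dominates.\<close>
    define s where "s = 1 / (B + 1)"
    have s: "s > 0" "s * B \<le> 1" using B by (auto simp: s_def field_simps)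
    have "0 \<le> s * P * (s * B - 2)" using poly[of s] by (simp add: power2_eq_square algebra_simps)
    then show False using s P by (smt (verit) mult_pos_pos mult_pos_neg)
  qed
  with y show ?thesis using that by blast
qed

end

section \<open>Self-adjoint operators and the resolvent set\<close>

locale self_adjoint_operator = hilbert_space_on smul V ip
  for smul :: "complex \<Rightarrow> 'a \<Rightarrow> 'a::ab_group_add" and V and ip +
  fixes H :: "'a unbounded_operator"
  assumes linear: "linear_operator smul V H"
    and selfadj: "self_adjoint V ip H"
begin

lemma Dom_in [simp]: "u \<in> Dom H \<Longrightarrow> u \<in> V"
  using linear by (auto simp: linear_operator_def)

lemma app_in [simp]: "u \<in> Dom H \<Longrightarrow> app H u \<in> V"
  using linear by (auto simp: linear_operator_def)

lemma subspace_Dom: "subspace (Dom H)"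
  using linear by (auto simp: linear_operator_def)

lemma Dom_closed [simp, intro]:
  "0 \<in> Dom H"
  "\<lbrakk>u \<in> Dom H; v \<in> Dom H\<rbrakk> \<Longrightarrow> u + v \<in> Dom H"
  "\<lbrakk>u \<in> Dom H; v \<in> Dom H\<rbrakk> \<Longrightarrow> u - v \<in> Dom H"
  "u \<in> Dom H \<Longrightarrow> smul a u \<in> Dom H"
  using subspace_Dom by (auto simp: subspace_0 subspace_add subspace_diff subspace_scale)

lemma app_add: "\<lbrakk>u \<in> Dom H; v \<in> Dom H\<rbrakk> \<Longrightarrow> app H (u + v) = app H u + app H v"
  using linear by (auto simp: linear_operator_def)

lemma app_scale: "u \<in> Dom H \<Longrightarrow> app H (smul a u) = smul a (app H u)"
  using linear by (auto simp: linear_operator_def)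

lemma app_diff: "\<lbrakk>u \<in> Dom H; v \<in> Dom H\<rbrakk> \<Longrightarrow> app H (u - v) = app H u - app H v"
  using app_add[of "u - v" v] by simp

lemma in_adjoint_graph_iff: "(v, w) \<in> adjoint_graph V ip H \<longleftrightarrow> v \<in> Dom H \<and> w = app H v"
  using selfadj by (auto simp: self_adjoint_def op_graph_def)

lemma symmetric: "\<lbrakk>u \<in> Dom H; v \<in> Dom H\<rbrakk> \<Longrightarrow> ip (app H u) v = ip u (app H v)"
  using in_adjoint_graph_iff[of v "app H v"] by (auto simp: adjoint_graph_def)

lemma adjointI:
  assumes "v \<in> V" "w \<in> V" "\<And>u. u \<in> Dom H \<Longrightarrow> ip (app H u) v = ip u w"
  shows "v \<in> Dom H" "app H v = w"
  using in_adjoint_graph_iff[of v w] assms by (auto simp: adjoint_graph_def)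

definition shifted :: "real \<Rightarrow> 'a \<Rightarrow> 'a" where
  "shifted \<alpha> u = app H u - smul (complex_of_real \<alpha>) u"

lemma shifted_in [simp]: "u \<in> Dom H \<Longrightarrow> shifted \<alpha> u \<in> V"
  by (simp add: shifted_def)

lemma shifted_add: "\<lbrakk>u \<in> Dom H; v \<in> Dom H\<rbrakk> \<Longrightarrow> shifted \<alpha> (u + v) = shifted \<alpha> u + shifted \<alpha> v"
  by (simp add: shifted_def app_add scale_right_distrib)

lemma shifted_diff: "\<lbrakk>u \<in> Dom H; v \<in> Dom H\<rbrakk> \<Longrightarrow> shifted \<alpha> (u - v) = shifted \<alpha> u - shifted \<alpha> v"
  by (simp add: shifted_def app_diff scale_right_diff_distrib)

lemma shifted_scale: "u \<in> Dom H \<Longrightarrow> shifted \<alpha> (smul a u) = smul a (shifted \<alpha> u)"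
  by (simp add: shifted_def app_scale scale_right_diff_distrib mult.commute)

lemma shifted_symmetric:
  "\<lbrakk>u \<in> Dom H; v \<in> Dom H\<rbrakk> \<Longrightarrow> ip (shifted \<alpha> u) v = ip u (shifted \<alpha> v)"
  by (simp add: shifted_def f_diff f_diff_right f_scale f_scale_right symmetric)

lemma shifted_form_diagonal:
  "u \<in> Dom H \<Longrightarrow> Re (ip (shifted \<alpha> u) u) = quad_form ip H u - \<alpha> * (ip_norm ip u)\<^sup>2"
  by (simp add: shifted_def quad_form_def f_diff f_scale nrm_sq)

text \<open>
  The range of \<open>H - \<alpha>\<close> is complete: preimages of a Cauchy sequence are Cauchy by the lower bound,
  and the limit stays in the graph because a self-adjoint operator, being an adjoint, is closed. The
  range is also dense: a vector \<open>y\<close> orthogonal to it lies in the domain of the adjoint, which is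
  \<open>H\<close>, with \<open>H y = \<alpha> y\<close>, and so vanishes by the lower bound.
\<close>

lemma bounded_below_imp_not_in_spectrum:
  assumes c: "0 < c" and lower: "\<And>u. u \<in> Dom H \<Longrightarrow> c * ip_norm ip u \<le> ip_norm ip (shifted \<alpha> u)"
  shows "\<alpha> \<notin> real_spectrum smul V ip H"
proof -
  let ?R = "shifted \<alpha> ` Dom H"
  have inj: "inj_on (shifted \<alpha>) (Dom H)"
  proof (rule inj_onI)
    fix u v assume uv: "u \<in> Dom H" "v \<in> Dom H" "shifted \<alpha> u = shifted \<alpha> v"
    then have "c * ip_norm ip (u - v) \<le> 0"
      using lower[of "u - v"] by (simp add: shifted_diff)
    then have "ip_norm ip (u - v) = 0"
      using c nrm_nonneg[of "u - v"] uv by (simp add: mult_le_0_iff)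
    then show "u = v" using nrm_eq_0[of "u - v"] uv by simp
  qed
  have "subspace ?R"
    unfolding subspace_def
  proof (safe)
    show "0 \<in> ?R" using shifted_scale[of 0 \<alpha> 0] by (force simp: image_iff)
    show "shifted \<alpha> u + shifted \<alpha> v \<in> ?R" if "u \<in> Dom H" "v \<in> Dom H" for u v
      using that shifted_add[of u v \<alpha>] by (metis Dom_closed(2) image_eqI)
    show "smul a (shifted \<alpha> u) \<in> ?R" if "u \<in> Dom H" for u a
      using that shifted_scale[of u \<alpha> a] by (metis Dom_closed(4) image_eqI)
  qed
  note R_subspace = this
  have "\<exists>l\<in>?R. (\<lambda>n. ip_norm ip (X n - l)) \<longlonglongrightarrow> 0"
    if XR: "\<And>n. X n \<in> ?R"
      and X: "\<And>e. 0 < e \<Longrightarrow> \<exists>N. \<forall>m\<ge>N. \<forall>n\<ge>N. ip_norm ip (X m - X n) < e" for X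
  proof -
    have "\<forall>n. \<exists>u. u \<in> Dom H \<and> X n = shifted \<alpha> u" using XR by blast
    then obtain U where U: "\<And>n. U n \<in> Dom H" "\<And>n. X n = shifted \<alpha> (U n)" by metis
    have XV: "X n \<in> V" for n using U by simp
    obtain x where x: "x \<in> V" "(\<lambda>n. ip_norm ip (X n - x)) \<longlonglongrightarrow> 0"
      using complete_V[OF XV X] by blast
    have "\<exists>u\<in>V. (\<lambda>n. ip_norm ip (U n - u)) \<longlonglongrightarrow> 0"
    proof (rule complete_V)
      show "U n \<in> V" for n using U by simp
      fix e :: real assume "0 < e"
      then obtain N where N: "\<And>m n. N \<le> m \<Longrightarrow> N \<le> n \<Longrightarrow> ip_norm ip (X m - X n) < c * e"
        using X[of "c * e"] c by auto
      have "ip_norm ip (U m - U n) < e" if "N \<le> m" "N \<le> n" for m n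
      proof -
        have "c * ip_norm ip (U m - U n) < c * e"
          using lower[of "U m - U n"] N[OF that] U by (simp add: shifted_diff)
        then show ?thesis using c by simp
      qed
      then show "\<exists>N. \<forall>m\<ge>N. \<forall>n\<ge>N. ip_norm ip (U m - U n) < e" by blast
    qed
    then obtain u where u: "u \<in> V" "(\<lambda>n. ip_norm ip (U n - u)) \<longlonglongrightarrow> 0" by blast
    have "ip (app H w) u = ip w (x + smul (complex_of_real \<alpha>) u)" if w: "w \<in> Dom H" for w
    proof -
      have "(\<lambda>n. ip (app H w) (U n)) \<longlonglongrightarrow> ip (app H w) u"
        using U u w by (intro f_tendsto_right) auto
      moreover have "ip (app H w) (U n) = ip w (X n) + of_real \<alpha> * ip w (U n)" for n
      proof -
        have "app H (U n) = X n + smul (complex_of_real \<alpha>) (U n)"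
          using U by (simp add: shifted_def)
        then show ?thesis using U w XV by (simp add: symmetric f_add_right f_scale_right)
      qed
      moreover have "(\<lambda>n. ip w (X n) + of_real \<alpha> * ip w (U n))
          \<longlonglongrightarrow> ip w x + of_real \<alpha> * ip w u"
        using U u w x XV by (intro tendsto_intros f_tendsto_right) auto
      ultimately show ?thesis
        using LIMSEQ_unique u w x by (simp add: f_add_right f_scale_right)
    qed
    then have "u \<in> Dom H" "app H u = x + smul (complex_of_real \<alpha>) u"
      using adjointI[of u "x + smul (complex_of_real \<alpha>) u"] u x by auto
    then have "x \<in> ?R" by (force simp: shifted_def image_iff)
    with x show ?thesis by blast
  qed
  note R_complete = this
  have orth: "y = 0" if y: "y \<in> V" "\<And>r. r \<in> ?R \<Longrightarrow> ip r y = 0" for y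
  proof -
    have "ip (app H u) y = ip u (smul (complex_of_real \<alpha>) y)" if "u \<in> Dom H" for u
      using y that by (force simp: shifted_def f_diff f_scale f_scale_right)
    then have "y \<in> Dom H" "app H y = smul (complex_of_real \<alpha>) y"
      using adjointI[of y "smul (complex_of_real \<alpha>) y"] y by auto
    then have "c * ip_norm ip y \<le> 0"
      using lower[of y] by (simp add: shifted_def)
    then have "ip_norm ip y = 0"
      using c nrm_nonneg[of y] y by (simp add: mult_le_0_iff)
    then show ?thesis using nrm_eq_0 y by blast
  qed
  have "V \<subseteq> ?R"
  proof
    fix x assume x: "x \<in> V"
    show "x \<in> ?R"
    proof (rule ccontr)
      assume nx: "x \<notin> ?R"
      show False
      proof (rule orthogonal_vector_exists[OF R_subspace _ R_complete x nx])
        show "?R \<subseteq> V" by auto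
        fix y assume "y \<in> V" "y \<noteq> 0" "\<And>r. r \<in> ?R \<Longrightarrow> ip r y = 0"
        then show False using orth[of y] by blast
      qed
    qed
  qed
  then have "bij_betw (shifted \<alpha>) (Dom H) V"
    using inj by (auto simp: bij_betw_def)
  moreover have "\<forall>u\<in>Dom H. ip_norm ip u \<le> (1 / c) * ip_norm ip (shifted \<alpha> u)"
    using lower c by (simp add: field_simps)
  ultimately show ?thesis
    unfolding real_spectrum_def spectrum_def resolvent_set_def shifted_def by blast
qed

lemma not_in_spectrum_bijective:
  assumes "\<alpha> \<notin> real_spectrum smul V ip H"
  shows "bij_betw (shifted \<alpha>) (Dom H) V"
  using assms unfolding real_spectrum_def spectrum_def resolvent_set_def shifted_def by auto

lemma not_in_spectrum_bounded_below:
  assumes "\<alpha> \<notin> real_spectrum smul V ip H"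
  obtains M where "0 < M" "\<And>u. u \<in> Dom H \<Longrightarrow> ip_norm ip u \<le> M * ip_norm ip (shifted \<alpha> u)"
proof -
  obtain M where M: "\<And>u. u \<in> Dom H \<Longrightarrow> ip_norm ip u \<le> M * ip_norm ip (shifted \<alpha> u)"
    using assms unfolding real_spectrum_def spectrum_def resolvent_set_def shifted_def by auto
  have "ip_norm ip u \<le> max M 1 * ip_norm ip (shifted \<alpha> u)" if "u \<in> Dom H" for u
    by (rule order_trans[OF M[OF that] mult_right_mono]) (use nrm_nonneg that in auto)
  then show ?thesis using that[of "max M 1"] by simp
qed

lemma in_spectrum_approx_eigenvector:
  assumes "\<alpha> \<in> real_spectrum smul V ip H" "0 < \<delta>"
  obtains u where "u \<in> Dom H" "ip_norm ip u = 1" "ip_norm ip (shifted \<alpha> u) < \<delta>"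
proof -
  obtain u where u: "u \<in> Dom H" "ip_norm ip (shifted \<alpha> u) < \<delta> * ip_norm ip u"
    using bounded_below_imp_not_in_spectrum[of \<delta> \<alpha>] assms by force
  then have "0 < \<delta> * ip_norm ip u"
    using nrm_nonneg[of "shifted \<alpha> u"] by simp
  then have pos: "0 < ip_norm ip u"
    using assms(2) by (simp add: zero_less_mult_iff)
  let ?v = "smul (of_real (1 / ip_norm ip u)) u"
  show ?thesis
  proof (rule that[of ?v])
    show "?v \<in> Dom H" using u by simp
    show "ip_norm ip ?v = 1" using u pos by (subst nrm_scale) (auto simp: norm_divide)
    show "ip_norm ip (shifted \<alpha> ?v) < \<delta>"
      using u pos by (simp add: shifted_scale nrm_scale norm_divide field_simps)
  qed
qed

text \<open>
  If \<open>\<alpha> < 0\<close>, then \<open>((H - \<alpha>) u, u) \<ge> -\<alpha> \<parallel>u\<parallel>\<^sup>2\<close>, so \<open>H - \<alpha>\<close> is bounded below.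
\<close>

lemma nonnegative_spectrum:
  assumes "nonnegative ip H" "\<alpha> \<in> real_spectrum smul V ip H"
  shows "0 \<le> \<alpha>"
proof (rule ccontr)
  assume neg: "\<not> 0 \<le> \<alpha>"
  have "- \<alpha> * ip_norm ip u \<le> ip_norm ip (shifted \<alpha> u)" if u: "u \<in> Dom H" for u
  proof (cases "u = 0")
    case True
    then show ?thesis using shifted_in[OF u, of \<alpha>] nrm_nonneg by simp
  next
    case False
    have "- \<alpha> * (ip_norm ip u)\<^sup>2 \<le> Re (ip (shifted \<alpha> u) u)"
      using assms(1) u by (simp add: nonnegative_def quad_form_def shifted_def f_diff f_scale nrm_sq)
    also have "\<dots> \<le> ip_norm ip (shifted \<alpha> u) * ip_norm ip u"
      by (rule order_trans[OF complex_Re_le_cmod cauchy_schwarz]) (use u in auto)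
    finally have "ip_norm ip u * (- \<alpha> * ip_norm ip u) \<le> ip_norm ip u * ip_norm ip (shifted \<alpha> u)"
      by (simp add: power2_eq_square mult_ac)
    then show ?thesis using nrm_pos[of u] u False by (subst (asm) mult_le_cancel_left_pos) auto
  qed
  then show False
    using bounded_below_imp_not_in_spectrum[of "- \<alpha>" \<alpha>] neg assms(2) by auto
qed

section \<open>The resolvent norm at the centre of a spectral gap\<close>

text \<open>
  Let \<open>T = (H - \<alpha>)\<^sup>-\<^sup>1\<close>, a bounded symmetric operator, and \<open>m = \<parallel>T\<parallel>\<close>. The square of a bounded
  symmetric operator has its norm as an approximate eigenvalue, so \<open>(T - m) (T + m)\<close> is not bounded
  below, and neither is \<open>(H - \<alpha> - s) (H - \<alpha> + s)\<close> with \<open>s = 1/m\<close>. If \<open>s < r\<close>, both factors are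
  bounded below by the gap hypothesis, a contradiction. Below, \<open>T\<close> is not named: \<open>y = T x\<close> and
  \<open>z = T y\<close>, and the quotients \<open>\<parallel>y\<parallel>/\<parallel>x\<parallel>\<close> form the set \<open>S\<close> with supremum \<open>m\<close>.
\<close>

lemma spectral_gap_bounds_shifted:
  assumes r: "0 < r" and gap: "\<And>\<mu>. \<bar>\<mu> - \<alpha>\<bar> \<le> r \<Longrightarrow> \<mu> \<notin> real_spectrum smul V ip H"
    and u: "u \<in> Dom H"
  shows "r * ip_norm ip u \<le> ip_norm ip (shifted \<alpha> u)"
proof (rule ccontr)
  assume contra: "\<not> ?thesis"
  let ?N = "ip_norm ip"
  define S where "S = {?N y / ?N (shifted \<alpha> y) | y. y \<in> Dom H \<and> y \<noteq> 0}"
  define m where "m = Sup S"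
  have "\<alpha> \<notin> real_spectrum smul V ip H" using gap r by simp
  then obtain M0 where M0: "0 < M0" "\<And>u. u \<in> Dom H \<Longrightarrow> ?N u \<le> M0 * ?N (shifted \<alpha> u)"
    using not_in_spectrum_bounded_below by blast
  have pos: "0 < ?N (shifted \<alpha> y)" if "y \<in> Dom H" "y \<noteq> 0" for y
  proof -
    have "0 < M0 * ?N (shifted \<alpha> y)"
      using M0(2)[OF that(1)] nrm_pos[of y] that by simp
    then show ?thesis using M0(1) by (simp add: zero_less_mult_iff)
  qed
  have u0: "u \<noteq> 0" using contra shifted_in[OF u, of \<alpha>] nrm_nonneg by fastforce
  have bdd: "bdd_above S"
    unfolding S_def using M0(2) pos by (intro bdd_aboveI[of _ M0]) (auto simp: divide_le_eq)
  have le_m: "?N y \<le> m * ?N (shifted \<alpha> y)" if "y \<in> Dom H" for y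
  proof (cases "y = 0")
    case True
    then show ?thesis using shifted_scale[of 0 \<alpha> 0] by simp
  next
    case False
    then have "?N y / ?N (shifted \<alpha> y) \<le> m"
      unfolding m_def using that by (intro cSup_upper bdd) (auto simp: S_def)
    then show ?thesis using pos[OF that False] by (simp add: divide_le_eq)
  qed
  have m: "1 / r < m"
  proof -
    have "?N u \<le> m * ?N (shifted \<alpha> u)" using le_m u .
    moreover have "?N (shifted \<alpha> u) < r * ?N u" using contra by simp
    moreover have "1 / r < ?N u / ?N (shifted \<alpha> u)"
      using contra r pos[OF u u0] by (simp add: field_simps)
    moreover have "?N u / ?N (shifted \<alpha> u) \<le> m"
      using le_m[OF u] pos[OF u u0] by (simp add: divide_le_eq)
    ultimately show ?thesis by linarith
  qed
  have m0: "0 < m" by (rule less_trans[OF _ m]) (simp add: r)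
  define s where "s = 1 / m"
  have s: "0 < s" "s < r" using m m0 r by (auto simp: s_def field_simps)
  obtain M1 where M1: "0 < M1" "\<And>u. u \<in> Dom H \<Longrightarrow> ?N u \<le> M1 * ?N (shifted (\<alpha> - s) u)"
    using not_in_spectrum_bounded_below[of "\<alpha> - s"] gap s by auto
  obtain M2 where M2: "0 < M2" "\<And>u. u \<in> Dom H \<Longrightarrow> ?N u \<le> M2 * ?N (shifted (\<alpha> + s) u)"
    using not_in_spectrum_bounded_below[of "\<alpha> + s"] gap s by auto
  define K where "K = (M1 * M2)\<^sup>2"
  have K: "0 < K" using M1 M2 by (simp add: K_def)
  \<comment> \<open>With \<open>t = \<parallel>y\<parallel>/\<parallel>x\<parallel>\<close> this reads \<open>t\<^sup>4 \<le> K (1 - t\<^sup>2/m\<^sup>2)\<close>, which keeps \<open>t\<close> away from \<open>m\<close>.\<close>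
  have key: "(?N y)^4 \<le> K * ((?N (shifted \<alpha> y))\<^sup>2 - s\<^sup>2 * (?N y)\<^sup>2) * (?N (shifted \<alpha> y))\<^sup>2"
    if y: "y \<in> Dom H" for y
  proof -
    let ?x = "shifted \<alpha> y"
    obtain z where z: "z \<in> Dom H" "shifted \<alpha> z = y"
      using not_in_spectrum_bijective[of \<alpha>] gap[of \<alpha>] r y
      by (auto simp: bij_betw_def) (metis Dom_in imageE)
    have yy: "(?N y)\<^sup>2 = Re (ip ?x z)"
      using shifted_symmetric[of y z \<alpha>] z y by (simp add: nrm_sq)
    have Nz: "s * ?N z \<le> ?N y" using le_m[OF z(1)] z m0 by (simp add: s_def field_simps)
    have Nzy: "(?N y)\<^sup>2 \<le> ?N ?x * ?N z"
      unfolding yy using cauchy_schwarz[of ?x z] complex_Re_le_cmod[of "ip ?x z"] y z by simp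
    let ?w = "?x - smul (of_real (s\<^sup>2)) z"
    have w1: "shifted (\<alpha> - s) z = y + smul (of_real s) z"
      using z by (simp add: shifted_def scale_left_diff_distrib flip: z(2))
    \<comment> \<open>\<open>(H - \<alpha> - s) (H - \<alpha> + s) z = x - s\<^sup>2 z\<close>, one factor at a time.\<close>
    have "shifted (\<alpha> + s) (y + smul (of_real s) z)
        = shifted \<alpha> (y + smul (of_real s) z) - smul (of_real s) (y + smul (of_real s) z)"
      by (simp add: shifted_def scale_left_distrib)
    also have "\<dots> = ?w"
      using z y by (simp add: shifted_add shifted_scale scale_right_distrib power2_eq_square)
    finally have w2: "shifted (\<alpha> + s) (y + smul (of_real s) z) = ?w" .
    have "?N z \<le> M1 * ?N (y + smul (of_real s) z)"
      using M1(2)[OF z(1)] w1 by simp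
    also have "\<dots> \<le> M1 * (M2 * ?N ?w)"
      using M2(2)[of "y + smul (of_real s) z"] M1(1) y z w2 by simp
    finally have "(?N z)\<^sup>2 \<le> (M1 * M2 * ?N ?w)\<^sup>2"
      using nrm_nonneg[of z] z by (intro power_mono) (auto simp: mult_ac)
    then have z_le: "(?N z)\<^sup>2 \<le> K * (?N ?w)\<^sup>2" by (simp add: K_def power_mult_distrib)
    have "(?N ?w)\<^sup>2 = (?N ?x)\<^sup>2 - 2 * s\<^sup>2 * (?N y)\<^sup>2 + s\<^sup>2 * (s * ?N z)\<^sup>2"
    proof -
      have "Re (ip ?x (smul (of_real (s\<^sup>2)) z)) = s\<^sup>2 * Re (ip ?x z)"
        using y z by (simp only: f_scale_right shifted_in Dom_in) simp
      moreover have "?N (smul (of_real (s\<^sup>2)) z) = s\<^sup>2 * ?N z"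
        using z by (simp only: nrm_scale Dom_in norm_of_real) simp
      ultimately show ?thesis
        unfolding yy using y z nrm_sq_diff[of ?x "smul (of_real (s\<^sup>2)) z"]
        by (simp only: shifted_in Dom_in W_closed) (simp add: power2_eq_square algebra_simps)
    qed
    also have "\<dots> \<le> (?N ?x)\<^sup>2 - 2 * s\<^sup>2 * (?N y)\<^sup>2 + s\<^sup>2 * (?N y)\<^sup>2"
      using Nz s nrm_nonneg[of z] z by (intro add_left_mono mult_left_mono power_mono) auto
    finally have "(?N ?w)\<^sup>2 \<le> (?N ?x)\<^sup>2 - s\<^sup>2 * (?N y)\<^sup>2" by simp
    then have "(?N z)\<^sup>2 \<le> K * ((?N ?x)\<^sup>2 - s\<^sup>2 * (?N y)\<^sup>2)"
      using z_le K by (meson mult_left_mono order_trans less_imp_le)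
    then have "(?N z)\<^sup>2 * (?N ?x)\<^sup>2 \<le> K * ((?N ?x)\<^sup>2 - s\<^sup>2 * (?N y)\<^sup>2) * (?N ?x)\<^sup>2"
      by (intro mult_right_mono) auto
    moreover have "((?N y)\<^sup>2)\<^sup>2 \<le> (?N ?x * ?N z)\<^sup>2"
      using Nzy by (intro power_mono) auto
    moreover have "((?N y)\<^sup>2)\<^sup>2 = (?N y)^4" by (simp flip: power_mult)
    ultimately show ?thesis by (simp add: power_mult_distrib mult_ac)
  qed
  have quot: "t ^ 4 \<le> K * (1 - s\<^sup>2 * t\<^sup>2)" if t: "t \<in> S" for t
  proof -
    obtain y where y: "y \<in> Dom H" "y \<noteq> 0" "t = ?N y / ?N (shifted \<alpha> y)"
      using t unfolding S_def by blast
    define x where "x = ?N (shifted \<alpha> y)"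
    have x: "0 < x" using pos y by (simp add: x_def)
    have Ny: "?N y = t * x" using x y by (simp add: x_def)
    have "t ^ 4 * x ^ 4 \<le> (K * (1 - s\<^sup>2 * t\<^sup>2)) * x ^ 4"
      using key[OF y(1)] unfolding Ny x_def[symmetric]
      by (simp add: algebra_simps power4_eq_xxxx power2_eq_square)
    then show ?thesis using x by simp
  qed
  \<comment> \<open>Every \<open>t \<in> S\<close> above \<open>m/2\<close> has \<open>t\<^sup>2 \<le> q < m\<^sup>2\<close>, so \<open>m\<close> cannot be the supremum.\<close>
  define q where "q = m\<^sup>2 * (1 - (m / 2) ^ 4 / K)"
  have t_le: "t \<le> max (m / 2) (sqrt q)" if t: "t \<in> S" for t
  proof (cases "t \<le> m / 2")
    case False
    have "(m / 2) ^ 4 \<le> t ^ 4" using False m0 by (intro power_mono) auto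
    then have "(m / 2) ^ 4 \<le> K * (1 - t\<^sup>2 / m\<^sup>2)" 
      by (rule order_trans) (use quot[OF t] in \<open>simp add: s_def power_divide\<close>)
    then have "(m / 2) ^ 4 / K \<le> 1 - t\<^sup>2 / m\<^sup>2" using K by (simp add: divide_le_eq mult.commute)
    then have "t\<^sup>2 / m\<^sup>2 \<le> 1 - (m / 2) ^ 4 / K" by simp
    then have "t\<^sup>2 \<le> q" using m0 by (simp add: q_def divide_le_eq mult.commute)
    then have "t \<le> sqrt q" by (rule real_le_rsqrt)
    then show ?thesis by simp
  qed simp
  have "S \<noteq> {}" using u u0 by (auto simp: S_def)
  then have "m \<le> max (m / 2) (sqrt q)" unfolding m_def using t_le by (intro cSup_least) (auto simp: m_def)
  then have "m \<le> sqrt q" using m0 by auto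
  moreover have "sqrt q < sqrt (m\<^sup>2)"
    unfolding q_def using m0 K by (intro real_sqrt_less_mono) simp
  ultimately show False using m0 by simp
qed

end

section \<open>The energy norm of a nonnegative operator\<close>

locale nonnegative_operator = self_adjoint_operator +
  assumes nonneg: "nonnegative ip H"
begin

definition energy :: "'a \<Rightarrow> 'a \<Rightarrow> complex" where
  "energy u v = ip (app H u) v + ip u v"

sublocale energy: psd_form smul "Dom H" energy
proof
  show "energy v u = cnj (energy u v)" if "u \<in> Dom H" "v \<in> Dom H" for u v
    using that f_commute[of u v] f_commute[of "app H u" v] symmetric[of v u] by (simp add: energy_def)
  show "0 \<le> Re (energy u u)" if "u \<in> Dom H" for u
    using that nonneg f_nonneg[of u] by (simp add: energy_def nonnegative_def quad_form_def)
qed (simp_all add: subspace_Dom energy_def app_add app_scale f_add f_scale algebra_simps)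

abbreviation "energy_norm \<equiv> ip_norm energy"

lemma energy_norm_sq:
  "u \<in> Dom H \<Longrightarrow> (energy_norm u)\<^sup>2 = (ip_norm ip u)\<^sup>2 + quad_form ip H u"
  by (simp add: energy.nrm_sq nrm_sq energy_def quad_form_def)

lemma nrm_le_energy_norm:
  assumes u: "u \<in> Dom H"
  shows "ip_norm ip u \<le> energy_norm u"
proof (rule power2_le_imp_le)
  show "(ip_norm ip u)\<^sup>2 \<le> (energy_norm u)\<^sup>2"
    using nonneg u by (simp add: energy_norm_sq nonnegative_def)
  show "0 \<le> energy_norm u" by (rule energy.nrm_nonneg[OF u])
qed

lemma shifted_form_bound:
  assumes u: "u \<in> Dom H" and v: "v \<in> Dom H" and \<alpha>: "0 \<le> \<alpha>"
  shows "cmod (ip (shifted \<alpha> u) v) \<le> (2 + \<alpha>) * energy_norm u * energy_norm v"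
proof -
  have "ip (shifted \<alpha> u) v = energy u v - of_real (1 + \<alpha>) * ip u v"
    using u v by (simp add: shifted_def energy_def f_diff f_scale algebra_simps)
  then have "cmod (ip (shifted \<alpha> u) v) \<le> cmod (energy u v) + (1 + \<alpha>) * cmod (ip u v)"
    using norm_triangle_ineq4[of "energy u v" "of_real (1 + \<alpha>) * ip u v"] \<alpha>
    by (simp only: norm_mult norm_of_real)
  moreover have "cmod (energy u v) \<le> energy_norm u * energy_norm v"
    using energy.cauchy_schwarz u v .
  moreover have "cmod (ip u v) \<le> energy_norm u * energy_norm v"
    by (rule order_trans[OF cauchy_schwarz mult_mono])
      (use u v in \<open>auto intro: nrm_le_energy_norm nrm_nonneg energy.nrm_nonneg\<close>)
  then have "(1 + \<alpha>) * cmod (ip u v) \<le> (1 + \<alpha>) * (energy_norm u * energy_norm v)"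
    using \<alpha> by (intro mult_left_mono) auto
  ultimately show ?thesis by (simp add: algebra_simps)
qed

lemma form_coreD:
  assumes "form_core ip H C" "u \<in> Dom H" "0 < \<delta>"
  obtains v where "v \<in> C" "v \<in> Dom H" "energy_norm (u - v) < \<delta>"
proof -
  obtain v where v: "v \<in> C" "v \<in> Dom H" "(ip_norm ip (u - v))\<^sup>2 + quad_form ip H (u - v) < \<delta>\<^sup>2"
    using assms unfolding form_core_def by (meson subsetD zero_less_power)
  then have "(energy_norm (u - v))\<^sup>2 < \<delta>\<^sup>2" using assms by (simp add: energy_norm_sq)
  then show ?thesis using that v assms(3) by (meson power_less_imp_less_base less_imp_le)
qed

text \<open>
  An approximate eigenvector \<open>u\<close> in the operator domain is moved into \<open>C\<close> by an amount that is small
  in the energy norm only. The equation \<open>(H - \<alpha>) v \<approx> 0\<close> may be lost in the Hilbert space norm, but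
  its weak form survives, and the weak form is all that the comparison of the two operators uses.
\<close>

lemma approx_eigenvector_in_core:
  assumes spec: "\<alpha> \<in> real_spectrum smul V ip H" and core: "form_core ip H C"
    and \<delta>: "0 < \<delta>" "\<delta> \<le> 1 / 4"
  obtains v where "v \<in> C" "v \<in> Dom H" "1 / 2 \<le> ip_norm ip v" "energy_norm v \<le> 2 * (1 + \<alpha>)"
    "\<And>w. w \<in> Dom H \<Longrightarrow> cmod (ip (shifted \<alpha> v) w) \<le> 3 * (1 + \<alpha>) * \<delta> * energy_norm w"
proof -
  have \<alpha>: "0 \<le> \<alpha>" using nonnegative_spectrum nonneg spec by blast
  obtain u where u: "u \<in> Dom H" "ip_norm ip u = 1" "ip_norm ip (shifted \<alpha> u) < \<delta>"
    using in_spectrum_approx_eigenvector[OF spec \<delta>(1)] .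
  obtain v where v: "v \<in> C" "v \<in> Dom H" "energy_norm (u - v) < \<delta>"
    using form_coreD[OF core u(1) \<delta>(1)] .
  have "quad_form ip H u = \<alpha> + Re (ip (shifted \<alpha> u) u)"
    using u nrm_sq[of u] by (simp add: quad_form_def shifted_def f_diff f_scale)
  also have "\<dots> \<le> \<alpha> + \<delta>"
    using cauchy_schwarz[of "shifted \<alpha> u" u] complex_Re_le_cmod[of "ip (shifted \<alpha> u) u"] u by simp
  finally have "(energy_norm u)\<^sup>2 \<le> 1 + \<alpha> + 1 / 4"
    using u \<delta> by (simp add: energy_norm_sq)
  also have "\<dots> \<le> (3 / 2 * (1 + \<alpha>))\<^sup>2"
    using \<alpha> by (simp add: power2_eq_square algebra_simps)
  finally have "energy_norm u \<le> 3 / 2 * (1 + \<alpha>)"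
    by (rule power2_le_imp_le) (use \<alpha> in simp)
  then have Ev: "energy_norm v \<le> 2 * (1 + \<alpha>)"
    using energy.nrm_triangle_diff[OF v(2) u(1)] energy.nrm_minus_commute[OF v(2) u(1)] v \<delta> \<alpha>
    by (simp add: algebra_simps)
  have "1 \<le> ip_norm ip v + ip_norm ip (u - v)"
    using nrm_triangle_diff[of u v] u v by simp
  moreover have "ip_norm ip (u - v) < \<delta>"
    using nrm_le_energy_norm[of "u - v"] u v by simp
  ultimately have "1 / 2 \<le> ip_norm ip v" using \<delta> by linarith
  moreover have "cmod (ip (shifted \<alpha> v) w) \<le> 3 * (1 + \<alpha>) * \<delta> * energy_norm w" if w: "w \<in> Dom H" for w
  proof -
    have "ip (shifted \<alpha> v) w = ip (shifted \<alpha> u) w - ip (shifted \<alpha> (u - v)) w"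
      using u v w by (simp add: shifted_diff f_diff)
    then have "cmod (ip (shifted \<alpha> v) w) \<le> cmod (ip (shifted \<alpha> u) w) + cmod (ip (shifted \<alpha> (u - v)) w)"
      by (simp add: norm_triangle_ineq4)
    moreover have "cmod (ip (shifted \<alpha> u) w) \<le> \<delta> * energy_norm w"
    proof -
      have "cmod (ip (shifted \<alpha> u) w) \<le> ip_norm ip (shifted \<alpha> u) * ip_norm ip w"
        using u w by (intro cauchy_schwarz) auto
      also have "\<dots> \<le> \<delta> * energy_norm w"
        using u w \<delta> by (intro mult_mono nrm_le_energy_norm nrm_nonneg) auto
      finally show ?thesis .
    qed
    moreover have "cmod (ip (shifted \<alpha> (u - v)) w) \<le> (2 + \<alpha>) * \<delta> * energy_norm w"
    proof -
      have "cmod (ip (shifted \<alpha> (u - v)) w) \<le> (2 + \<alpha>) * energy_norm (u - v) * energy_norm w"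
        using u v w \<alpha> by (intro shifted_form_bound) auto
      also have "\<dots> \<le> (2 + \<alpha>) * \<delta> * energy_norm w"
        using v \<alpha> energy.nrm_nonneg[OF w] by (intro mult_right_mono mult_left_mono) auto
      finally show ?thesis .
    qed
    moreover have "\<delta> * energy_norm w + (2 + \<alpha>) * \<delta> * energy_norm w
        \<le> 3 * (1 + \<alpha>) * \<delta> * energy_norm w"
      using mult_nonneg_nonneg[OF mult_nonneg_nonneg[OF \<alpha> less_imp_le[OF \<delta>(1)]] energy.nrm_nonneg[OF w]]
      by (simp add: algebra_simps)
    ultimately show ?thesis by linarith
  qed
  ultimately show ?thesis using that v Ev by blast
qed

text \<open>
  Both sides are continuous in \<open>w\<close> for the energy norm, as \<open>v\<close> lies in the operator domain.
\<close>

lemma shifted_form_bound_from_core: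
  assumes core: "form_core ip H C" and v: "v \<in> Dom H" and E: "0 \<le> E"
    and bound: "\<And>w. w \<in> C \<Longrightarrow> cmod (ip (shifted \<alpha> v) w) \<le> E * energy_norm w"
    and w: "w \<in> Dom H"
  shows "cmod (ip (shifted \<alpha> v) w) \<le> E * energy_norm w"
proof (rule field_le_epsilon)
  fix e :: real assume e: "0 < e"
  define K where "K = ip_norm ip (shifted \<alpha> v)"
  have K: "0 \<le> K" unfolding K_def using v by (intro nrm_nonneg) simp
  define \<tau> where "\<tau> = e / (E + K + 1)"
  have "0 < \<tau>" "(E + K + 1) * \<tau> = e" using e E K by (auto simp: \<tau>_def)
  then have \<tau>: "0 < \<tau>" "E * \<tau> + K * \<tau> \<le> e" by (auto simp: algebra_simps)
  obtain x where x: "x \<in> C" "x \<in> Dom H" "energy_norm (w - x) < \<tau>"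
    using form_coreD[OF core w \<tau>(1)] .
  have "ip (shifted \<alpha> v) w = ip (shifted \<alpha> v) x + ip (shifted \<alpha> v) (w - x)"
    using v w x by (simp add: f_diff_right)
  then have "cmod (ip (shifted \<alpha> v) w) \<le> cmod (ip (shifted \<alpha> v) x) + cmod (ip (shifted \<alpha> v) (w - x))"
    by (simp add: norm_triangle_ineq)
  moreover have "cmod (ip (shifted \<alpha> v) x) \<le> E * energy_norm w + E * \<tau>"
  proof -
    have "energy_norm x \<le> energy_norm w + \<tau>"
      using energy.nrm_triangle_diff[OF x(2) w] energy.nrm_minus_commute[OF x(2) w] x by simp
    then have "E * energy_norm x \<le> E * (energy_norm w + \<tau>)" using E by (rule mult_left_mono)
    then show ?thesis using bound[OF x(1)] by (simp add: distrib_left)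
  qed
  moreover have "cmod (ip (shifted \<alpha> v) (w - x)) \<le> K * \<tau>"
  proof -
    have "cmod (ip (shifted \<alpha> v) (w - x)) \<le> K * ip_norm ip (w - x)"
      unfolding K_def using v w x by (intro cauchy_schwarz) auto
    also have "\<dots> \<le> K * \<tau>"
      using nrm_le_energy_norm[of "w - x"] w x K by (intro mult_left_mono) auto
    finally show ?thesis .
  qed
  ultimately show "cmod (ip (shifted \<alpha> v) w) \<le> E * energy_norm w + e" using \<tau> by linarith
qed

text \<open>
  In a gap of radius \<open>r\<close> about \<open>\<alpha>\<close>, test the bound with \<open>w = (H - \<alpha>)\<^sup>-\<^sup>1 v\<close>. Then the form equals
  \<open>\<parallel>v\<parallel>\<^sup>2\<close>, and \<open>\<parallel>w\<parallel>\<^sub>E\<^sup>2 = (v, w) + (1 + \<alpha>) \<parallel>w\<parallel>\<^sup>2 \<le> (1/r + (1 + \<alpha>)/r\<^sup>2) \<parallel>v\<parallel>\<^sup>2\<close>.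
\<close>

lemma small_form_imp_spectrum_near:
  assumes v: "v \<in> Dom H" and \<alpha>: "0 \<le> \<alpha>" and r: "0 < r"
    and bound: "\<And>w. w \<in> Dom H \<Longrightarrow> cmod (ip (shifted \<alpha> v) w) \<le> E * energy_norm w"
    and small: "E\<^sup>2 * (1 / r + (1 + \<alpha>) / r\<^sup>2) < (ip_norm ip v)\<^sup>2"
  shows "\<exists>\<beta>\<in>real_spectrum smul V ip H. \<bar>\<beta> - \<alpha>\<bar> \<le> r"
proof (rule ccontr)
  assume contra: "\<not> ?thesis"
  then have gap: "\<beta> \<notin> real_spectrum smul V ip H" if "\<bar>\<beta> - \<alpha>\<bar> \<le> r" for \<beta> using that by blast
  let ?n = "ip_norm ip v"
  have "0 \<le> E\<^sup>2 * (1 / r + (1 + \<alpha>) / r\<^sup>2)" using \<alpha> r by simp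
  then have n_pos: "0 < ?n\<^sup>2" using small by linarith
  have "v \<in> shifted \<alpha> ` Dom H"
    using bij_betw_imp_surj_on[OF not_in_spectrum_bijective[OF gap[of \<alpha>]]] r v by simp
  then obtain w where w: "w \<in> Dom H" "shifted \<alpha> w = v" by blast
  have "r * ip_norm ip w \<le> ?n"
    using spectral_gap_bounds_shifted[OF r _ w(1), of \<alpha>] gap w by simp
  then have nw: "ip_norm ip w \<le> ?n / r" using r by (simp add: field_simps)
  have "app H w = v + smul (of_real \<alpha>) w"
    unfolding w(2)[symmetric] by (simp add: shifted_def)
  then have "(energy_norm w)\<^sup>2 = Re (ip v w) + (1 + \<alpha>) * (ip_norm ip w)\<^sup>2"
    using v w by (simp add: energy_norm_sq quad_form_def nrm_sq f_add f_scale algebra_simps)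
  moreover have "Re (ip v w) \<le> ?n * (?n / r)"
  proof -
    have "Re (ip v w) \<le> ?n * ip_norm ip w"
      by (rule order_trans[OF complex_Re_le_cmod cauchy_schwarz]) (use v w in auto)
    also have "\<dots> \<le> ?n * (?n / r)"
      using nw nrm_nonneg[of v] v by (intro mult_left_mono) auto
    finally show ?thesis .
  qed
  moreover have "(1 + \<alpha>) * (ip_norm ip w)\<^sup>2 \<le> (1 + \<alpha>) * (?n / r)\<^sup>2"
    using nw nrm_nonneg[of w] w \<alpha> by (intro mult_left_mono power_mono) auto
  ultimately have Ew: "(energy_norm w)\<^sup>2 \<le> (1 / r + (1 + \<alpha>) / r\<^sup>2) * ?n\<^sup>2"
    by (simp add: power_divide distrib_right power2_eq_square)
  have "ip (shifted \<alpha> v) w = of_real (?n\<^sup>2)"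
    using shifted_symmetric[OF v w(1)] w v f_self_real[of v] nrm_sq[of v] by simp
  then have "?n\<^sup>2 \<le> E * energy_norm w"
    using bound[OF w(1)] by (simp del: of_real_power)
  then have "(?n\<^sup>2)\<^sup>2 \<le> E\<^sup>2 * (energy_norm w)\<^sup>2"
    using power_mono[of "?n\<^sup>2" "E * energy_norm w" 2] by (simp add: power_mult_distrib)
  also have "\<dots> \<le> E\<^sup>2 * ((1 / r + (1 + \<alpha>) / r\<^sup>2) * ?n\<^sup>2)"
    using Ew by (intro mult_left_mono) auto
  also have "\<dots> < ?n\<^sup>2 * ?n\<^sup>2"
    using mult_strict_right_mono[OF small, of "?n\<^sup>2"] n_pos by (simp add: mult.assoc)
  finally show False by (simp add: power2_eq_square)
qed

end

section \<open>Spectra of two operators with close forms\<close>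

text \<open>
  The hypotheses are phrased so that the two operators may be exchanged: the one-sided bounds
  with constant 2 are what closeness gives in the direction opposite to that of the bounds with \<open>\<eta>\<close>.
\<close>

lemma spectrum_near_if_forms_close:
  fixes smul :: "complex \<Rightarrow> 'a \<Rightarrow> 'a::ab_group_add"
  assumes op0: "nonnegative_operator smul V ip0 H0" and op1: "nonnegative_operator smul V ip1 H1"
    and C: "module.subspace smul C" and core0: "form_core ip0 H0 C" and core1: "form_core ip1 H1 C"
    and N_close: "\<And>u. u \<in> C \<Longrightarrow> \<bar>(ip_norm ip1 u)\<^sup>2 - (ip_norm ip0 u)\<^sup>2\<bar> \<le> \<eta> * (ip_norm ip0 u)\<^sup>2"
    and Q_close: "\<And>u. u \<in> C \<Longrightarrow> \<bar>quad_form ip1 H1 u - quad_form ip0 H0 u\<bar> \<le> \<eta> * quad_form ip0 H0 u"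
    and N_le: "\<And>u. u \<in> C \<Longrightarrow> (ip_norm ip0 u)\<^sup>2 \<le> 2 * (ip_norm ip1 u)\<^sup>2"
    and Q_le: "\<And>u. u \<in> C \<Longrightarrow> quad_form ip0 H0 u \<le> 2 * quad_form ip1 H1 u"
    and \<eta>: "0 < \<eta>" "\<eta> \<le> 1"
    and spec: "\<alpha> \<in> real_spectrum smul V ip1 H1"
  shows "\<exists>\<beta>\<in>real_spectrum smul V ip0 H0. \<bar>\<beta> - \<alpha>\<bar> \<le> 1000 * (1 + \<alpha>) ^ 4 * \<eta>"
proof -
  interpret A: nonnegative_operator smul V ip0 H0 by (rule op0)
  interpret B: nonnegative_operator smul V ip1 H1 by (rule op1)
  have C0: "u \<in> Dom H0" and C1: "u \<in> Dom H1" if "u \<in> C" for u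
    using core0 core1 that by (auto simp: form_core_def)
  interpret E: psd_form smul C A.energy
    using C C0 by (intro A.energy.psd_form_subspace) auto
  define b where "b = 1 + \<alpha>"
  have b: "1 \<le> b" using B.nonnegative_spectrum[OF B.nonneg spec] by (simp add: b_def)
  define D where "D = (\<lambda>u v. ip1 (B.shifted \<alpha> u) v - ip0 (A.shifted \<alpha> u) v)"
  have D_le: "cmod (D u v) \<le> 2 * (\<eta> * b) * A.energy_norm u * A.energy_norm v"
    if "u \<in> C" "v \<in> C" for u v
  proof (rule E.hermitian_form_bound)
    show "D (u + v) w = D u w + D v w" if "u \<in> C" "v \<in> C" "w \<in> C" for u v w
      using that C0 C1
      by (simp add: D_def A.shifted_add B.shifted_add A.f_add B.f_add)
    show "D (smul a u) w = a * D u w" if "u \<in> C" "w \<in> C" for a u w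
      using that C0 C1
      by (simp add: D_def A.shifted_scale B.shifted_scale A.f_scale B.f_scale algebra_simps)
    show "D v u = cnj (D u v)" if "u \<in> C" "v \<in> C" for u v
      using that C0[of u] C1[of u] C0[of v] C1[of v] A.f_commute[of "A.shifted \<alpha> u" v]
        B.f_commute[of "B.shifted \<alpha> u" v] A.shifted_symmetric[of v u] B.shifted_symmetric[of v u]
      by (simp add: D_def)
    show "\<bar>Re (D u u)\<bar> \<le> \<eta> * b * Re (A.energy u u)" if u: "u \<in> C" for u
    proof -
      let ?N0 = "(ip_norm ip0 u)\<^sup>2" and ?N1 = "(ip_norm ip1 u)\<^sup>2"
      let ?Q0 = "quad_form ip0 H0 u" and ?Q1 = "quad_form ip1 H1 u"
      have "Re (D u u) = (?Q1 - ?Q0) - \<alpha> * (?N1 - ?N0)"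
        using C0[OF u] C1[OF u]
        by (simp add: D_def A.shifted_form_diagonal B.shifted_form_diagonal algebra_simps)
      also have "\<bar>\<dots>\<bar> \<le> \<bar>?Q1 - ?Q0\<bar> + \<alpha> * \<bar>?N1 - ?N0\<bar>"
        using abs_triangle_ineq4[of "?Q1 - ?Q0" "\<alpha> * (?N1 - ?N0)"] b by (simp add: abs_mult b_def)
      also have "\<dots> \<le> \<eta> * ?Q0 + \<alpha> * (\<eta> * ?N0)"
        using N_close[OF u] Q_close[OF u] b by (intro add_mono mult_left_mono) (auto simp: b_def)
      also have "\<dots> \<le> \<eta> * b * (?N0 + ?Q0)"
      proof -
        have "0 \<le> ?Q0" using A.nonneg C0[OF u] by (simp add: nonnegative_def)
        then have "0 \<le> \<eta> * \<alpha> * ?Q0" "0 \<le> \<eta> * ?N0" using \<eta> b by (auto simp: b_def)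
        then show ?thesis by (simp add: b_def algebra_simps)
      qed
      also have "?N0 + ?Q0 = Re (A.energy u u)"
        using A.energy_norm_sq[OF C0[OF u]] A.energy.nrm_sq[OF C0[OF u]] by simp
      finally show ?thesis .
    qed
  qed (use that in auto)
  \<comment> \<open>Small enough for the defect of the approximate eigenvector not to exceed the error from the forms.\<close>
  define \<delta> where "\<delta> = \<eta> / 6"
  have \<delta>: "0 < \<delta>" "\<delta> \<le> 1 / 4" using \<eta> by (auto simp: \<delta>_def)
  obtain v where v: "v \<in> C" "v \<in> Dom H1" "1 / 2 \<le> ip_norm ip1 v" "B.energy_norm v \<le> 2 * (1 + \<alpha>)"
    "\<And>w. w \<in> Dom H1 \<Longrightarrow> cmod (ip1 (B.shifted \<alpha> v) w) \<le> 3 * (1 + \<alpha>) * \<delta> * B.energy_norm w"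
    using B.approx_eigenvector_in_core[OF spec core1 \<delta>] by blast
  have E_le: "B.energy_norm w \<le> 2 * A.energy_norm w" if w: "w \<in> C" for w
  proof (rule power2_le_imp_le)
    have "\<eta> * (ip_norm ip0 w)\<^sup>2 \<le> 1 * (ip_norm ip0 w)\<^sup>2" using \<eta> by (intro mult_right_mono) auto
    moreover have "0 \<le> quad_form ip0 H0 w" using A.nonneg C0[OF w] by (simp add: nonnegative_def)
    then have "\<eta> * quad_form ip0 H0 w \<le> 1 * quad_form ip0 H0 w" using \<eta> by (intro mult_right_mono) auto
    ultimately show "(B.energy_norm w)\<^sup>2 \<le> (2 * A.energy_norm w)\<^sup>2"
      using N_close[OF w] Q_close[OF w] \<open>0 \<le> quad_form ip0 H0 w\<close> zero_le_power2[of "ip_norm ip0 w"]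
      by (simp add: A.energy_norm_sq[OF C0[OF w]] B.energy_norm_sq[OF C1[OF w]] power_mult_distrib abs_le_iff)
    show "0 \<le> 2 * A.energy_norm w" using A.energy.nrm_nonneg[OF C0[OF w]] by simp
  qed
  have "A.energy_norm v \<le> 2 * B.energy_norm v"
  proof (rule power2_le_imp_le)
    show "(A.energy_norm v)\<^sup>2 \<le> (2 * B.energy_norm v)\<^sup>2"
      using N_le[OF v(1)] Q_le[OF v(1)] zero_le_power2[of "B.energy_norm v"]
      unfolding A.energy_norm_sq[OF C0[OF v(1)]] power_mult_distrib B.energy_norm_sq[OF v(2)] by simp
    show "0 \<le> 2 * B.energy_norm v" using B.energy.nrm_nonneg[OF v(2)] by simp
  qed
  then have Ev: "A.energy_norm v \<le> 4 * b" using v(4) by (simp add: b_def)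
  have on_C: "cmod (ip0 (A.shifted \<alpha> v) w) \<le> 9 * \<eta> * b\<^sup>2 * A.energy_norm w" if w: "w \<in> C" for w
  proof -
    let ?e = "A.energy_norm w"
    have e: "0 \<le> ?e" by (rule A.energy.nrm_nonneg[OF C0[OF w]])
    have "ip0 (A.shifted \<alpha> v) w = ip1 (B.shifted \<alpha> v) w - D v w" by (simp add: D_def)
    then have "cmod (ip0 (A.shifted \<alpha> v) w) \<le> cmod (ip1 (B.shifted \<alpha> v) w) + cmod (D v w)"
      by (simp add: norm_triangle_ineq4)
    moreover have "cmod (ip1 (B.shifted \<alpha> v) w) \<le> \<eta> * b * ?e"
    proof -
      have "3 * (1 + \<alpha>) * \<delta> = \<eta> * b / 2" by (simp add: b_def \<delta>_def)
      then have "cmod (ip1 (B.shifted \<alpha> v) w) \<le> (\<eta> * b / 2) * B.energy_norm w"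
        using v(5)[OF C1[OF w]] by (simp only:)
      also have "\<dots> \<le> (\<eta> * b / 2) * (2 * ?e)"
        using E_le[OF w] \<eta> b by (intro mult_left_mono) auto
      finally show ?thesis by simp
    qed
    moreover have "cmod (D v w) \<le> 2 * (\<eta> * b) * (4 * b) * ?e"
      by (rule order_trans[OF D_le[OF v(1) w]])
        (use Ev \<eta> b e in \<open>intro mult_right_mono mult_left_mono, auto\<close>)
    moreover have "\<eta> * b * ?e \<le> \<eta> * b\<^sup>2 * ?e"
      using \<eta> b e by (intro mult_right_mono mult_left_mono) (auto simp: power2_eq_square)
    ultimately show ?thesis by (simp add: power2_eq_square algebra_simps)
  qed
  define r where "r = 1000 * b ^ 4 * \<eta>"
  have r: "0 < r" using b \<eta> by (simp add: r_def)
  have "(1 / 2)\<^sup>2 \<le> (ip_norm ip1 v)\<^sup>2" using v(3) by (intro power_mono) auto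
  moreover have "\<eta> * (ip_norm ip0 v)\<^sup>2 \<le> 1 * (ip_norm ip0 v)\<^sup>2" using \<eta> by (intro mult_right_mono) auto
  ultimately have nv: "1 / 8 \<le> (ip_norm ip0 v)\<^sup>2"
    using N_close[OF v(1)] by (simp add: power2_eq_square)
  show ?thesis
    unfolding b_def[symmetric] r_def[symmetric]
  proof (rule A.small_form_imp_spectrum_near)
    show "v \<in> Dom H0" by (rule C0[OF v(1)])
    show "0 \<le> \<alpha>" using b by (simp add: b_def)
    show "0 < r" by (rule r)
    show "cmod (ip0 (A.shifted \<alpha> v) w) \<le> 9 * \<eta> * b\<^sup>2 * A.energy_norm w" if "w \<in> Dom H0" for w
      by (rule A.shifted_form_bound_from_core[OF core0 C0[OF v(1)] _ on_C that]) (use \<eta> in auto)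
    \<comment> \<open>The factor 1000 in \<open>r\<close> is chosen to make the following value less than \<open>1/8\<close>.\<close>
    have "(9 * \<eta> * b\<^sup>2)\<^sup>2 * (1 / r + (1 + \<alpha>) / r\<^sup>2) = 81 / 1000 * \<eta> + 81 / 1000000 * (1 / b ^ 3)"
      unfolding r_def b_def[symmetric] using b \<eta> by (simp add: field_simps eval_nat_numeral)
    also have "\<dots> \<le> 81 / 1000 * 1 + 81 / 1000000 * 1"
      using \<eta> b by (intro add_mono mult_left_mono) auto
    also have "\<dots> < 1 / 8" by simp
    finally show "(9 * \<eta> * b\<^sup>2)\<^sup>2 * (1 / r + (1 + \<alpha>) / r\<^sup>2) < (ip_norm ip0 v)\<^sup>2" using nv by linarith
  qed
qed

lemma eps_close_spectrum_near:
  fixes smul :: "complex \<Rightarrow> 'a \<Rightarrow> 'a::ab_group_add"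
  assumes pair: "operator_pair smul V ip0 ip1 H0 H1 C"
    and core: "form_core ip0 H0 C" "form_core ip1 H1 C"
    and \<epsilon>: "\<epsilon> < 1 / 2" and close: "eps_close ip0 ip1 H0 H1 C \<epsilon>"
  shows "\<And>\<alpha>. \<alpha> \<in> real_spectrum smul V ip1 H1 \<Longrightarrow>
      \<exists>\<beta>\<in>real_spectrum smul V ip0 H0. \<bar>\<beta> - \<alpha>\<bar> \<le> 1000 * (1 + \<alpha>) ^ 4 * \<epsilon>"
    and "\<And>\<alpha>. \<alpha> \<in> real_spectrum smul V ip0 H0 \<Longrightarrow>
      \<exists>\<beta>\<in>real_spectrum smul V ip1 H1. \<bar>\<beta> - \<alpha>\<bar> \<le> 1000 * (1 + \<alpha>) ^ 4 * (2 * \<epsilon>)"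
    and "real_spectrum smul V ip0 H0 \<subseteq> {0..}" "real_spectrum smul V ip1 H1 \<subseteq> {0..}"
proof -
  have \<epsilon>0: "0 < \<epsilon>" using close by (simp add: eps_close_def)
  have op: "nonnegative_operator smul V ip0 H0" "nonnegative_operator smul V ip1 H1"
    using pair by (simp_all add: operator_pair_def nonnegative_operator_def
        self_adjoint_operator_def self_adjoint_operator_axioms_def nonnegative_operator_axioms_def)
  interpret A: nonnegative_operator smul V ip0 H0 by (rule op)
  interpret B: nonnegative_operator smul V ip1 H1 by (rule op)
  have C: "module.subspace smul C" using pair by (simp add: operator_pair_def)
  \<comment> \<open>Closeness in both directions, with \<open>2\<epsilon>\<close> in place of \<open>\<epsilon>\<close> in the second.\<close>
  have two_sided: "\<bar>b - a\<bar> \<le> \<epsilon> * a" "a \<le> 2 * b" "\<bar>a - b\<bar> \<le> 2 * \<epsilon> * b" "b \<le> 2 * a"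
    if "(1 - \<epsilon>) * a \<le> b" "b \<le> (1 + \<epsilon>) * a" "0 \<le> a" for a b :: real
  proof -
    have "\<epsilon> * a \<le> 1 / 2 * a" using \<epsilon> that by (intro mult_right_mono) auto
    then have ab: "a \<le> 2 * b" "b \<le> 2 * a" using that by (auto simp: algebra_simps)
    then have "\<epsilon> * a \<le> \<epsilon> * (2 * b)" using \<epsilon>0 by (intro mult_left_mono) auto
    then show "\<bar>b - a\<bar> \<le> \<epsilon> * a" "a \<le> 2 * b" "\<bar>a - b\<bar> \<le> 2 * \<epsilon> * b" "b \<le> 2 * a"
      using that ab by (auto simp: abs_le_iff algebra_simps)
  qed
  have Q0: "0 \<le> quad_form ip0 H0 u" if "u \<in> C" for u
    using A.nonneg core that by (auto simp: nonnegative_def form_core_def)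
  note N = two_sided[of "(ip_norm ip0 u)\<^sup>2" "(ip_norm ip1 u)\<^sup>2" for u]
    and Q = two_sided[of "quad_form ip0 H0 u" "quad_form ip1 H1 u" for u]
  note close' = close[unfolded eps_close_def, THEN conjunct2, THEN conjunct2, rule_format]
  show "\<exists>\<beta>\<in>real_spectrum smul V ip0 H0. \<bar>\<beta> - \<alpha>\<bar> \<le> 1000 * (1 + \<alpha>) ^ 4 * \<epsilon>"
    if "\<alpha> \<in> real_spectrum smul V ip1 H1" for \<alpha>
    by (rule spectrum_near_if_forms_close[OF op C core _ _ _ _ _ _ that])
      (use \<epsilon> \<epsilon>0 N(1,2) Q(1,2) Q0 close' in auto)
  show "\<exists>\<beta>\<in>real_spectrum smul V ip1 H1. \<bar>\<beta> - \<alpha>\<bar> \<le> 1000 * (1 + \<alpha>) ^ 4 * (2 * \<epsilon>)"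
    if "\<alpha> \<in> real_spectrum smul V ip0 H0" for \<alpha>
    by (rule spectrum_near_if_forms_close[OF op(2,1) C core(2,1) _ _ _ _ _ _ that])
      (use \<epsilon> \<epsilon>0 N(3,4) Q(3,4) Q0 close' in auto)
  show "real_spectrum smul V ip0 H0 \<subseteq> {0..}" "real_spectrum smul V ip1 H1 \<subseteq> {0..}"
    using A.nonnegative_spectrum[OF A.nonneg] B.nonnegative_spectrum[OF B.nonneg] by auto
qed

section \<open>The pointed Gromov-Hausdorff distance\<close>

text \<open>
  The two sets lie in a common metric space and have the same base point, so the ambient distance
  nearly serves as the metric on their disjoint union. Since a point that belongs to both sets must
  have two copies at positive distance, \<open>r/4\<close> is added between the two parts; this is why the
  hypotheses require the accuracy \<open>r/2\<close> rather than \<open>r\<close>.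
\<close>

lemma pointed_GH_dist_le:
  fixes X Y :: "'a::metric_space set"
  assumes r: "0 < r"
    and XY: "\<And>x. \<lbrakk>x \<in> X; dist p x < 1 / r\<rbrakk> \<Longrightarrow> \<exists>y\<in>Y. dist x y \<le> r / 2"
    and YX: "\<And>y. \<lbrakk>y \<in> Y; dist p y < 1 / r\<rbrakk> \<Longrightarrow> \<exists>x\<in>X. dist x y \<le> r / 2"
  shows "pointed_GH_dist (X, p) (Y, p) \<le> r"
proof -
  define pt :: "'a + 'a \<Rightarrow> 'a" where "pt = case_sum id id"
  define d :: "'a + 'a \<Rightarrow> 'a + 'a \<Rightarrow> real" where
    "d = (\<lambda>a b. dist (pt a) (pt b) + (if isl a = isl b then 0 else r / 4))"
  have "Metric_space (X <+> Y) d"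
  proof
    show "0 \<le> d a b" for a b using r by (simp add: d_def)
    show "d a b = d b a" for a b by (simp add: d_def dist_commute eq_commute)
    show "(d a b = 0) = (a = b)" for a b
    proof
      assume "d a b = 0"
      then have "isl a = isl b" "pt a = pt b"
        using r by (auto simp: d_def add_nonneg_eq_0_iff split: if_splits)
      then show "a = b" by (cases a; cases b) (auto simp: pt_def)
    qed (simp add: d_def)
    show "d a c \<le> d a b + d b c" for a b c
      using dist_triangle[of "pt a" "pt c" "pt b"] r by (auto simp: d_def)
  qed
  then show ?thesis
    unfolding pointed_GH_dist_def prod.case
    by (intro cInf_lower bdd_belowI[of _ 0] CollectI conjI exI[of _ d])
      (use r XY YX in \<open>force simp: d_def pt_def\<close>)+
qed

text \<open>
  A point \<open>x\<close> of either spectrum in the ball of radius \<open>1/r\<close> about \<open>-1\<close> has \<open>1 + x < 1/r\<close>, hence a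
  point of the other spectrum within \<open>2000 \<epsilon> r\<^sup>-\<^sup>4\<close>. This equals \<open>r/2\<close> for \<open>r\<^sup>5 = 4000 \<epsilon>\<close>,
  which determines \<open>\<omega>\<close>.
\<close>

theorem theorem3p4:
  shows "(\<exists>c :: real \<Rightarrow> real. \<forall>A>0.
      \<forall>(smul :: complex \<Rightarrow> 'a \<Rightarrow> 'a::ab_group_add) V ip0 ip1 H0 H1 C \<epsilon>.
        operator_pair smul V ip0 ip1 H0 H1 C \<longrightarrow>
        form_core ip0 H0 C \<longrightarrow> form_core ip1 H1 C \<longrightarrow>
        0 < \<epsilon> \<longrightarrow> \<epsilon> < 1 / 2 \<longrightarrow> eps_close ip0 ip1 H0 H1 C \<epsilon> \<longrightarrow>
        (\<forall>\<mu> \<in> real_spectrum smul V ip1 H1 \<inter> {0..A}.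
           real_spectrum smul V ip0 H0 \<noteq> {} \<and>
           infdist \<mu> (real_spectrum smul V ip0 H0) < c A * \<epsilon> powr (1 / 3)))
    \<and> (\<exists>\<omega> :: real \<Rightarrow> real. (\<omega> \<longlongrightarrow> 0) (at_right 0) \<and>
      (\<forall>(smul :: complex \<Rightarrow> 'a \<Rightarrow> 'a::ab_group_add) V ip0 ip1 H0 H1 C \<epsilon>.
        operator_pair smul V ip0 ip1 H0 H1 C \<longrightarrow>
        form_core ip0 H0 C \<longrightarrow> form_core ip1 H1 C \<longrightarrow>
        0 < \<epsilon> \<longrightarrow> \<epsilon> < 1 / 2 \<longrightarrow> eps_close ip0 ip1 H0 H1 C \<epsilon> \<longrightarrow>
        pointed_GH_dist (pointed_spectrum (real_spectrum smul V ip0 H0))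
                        (pointed_spectrum (real_spectrum smul V ip1 H1)) \<le> \<omega> \<epsilon>))"
proof (intro conjI)
  define c :: "real \<Rightarrow> real" where "c = (\<lambda>A. 1001 * (1 + A) ^ 4)"
  show "\<exists>c :: real \<Rightarrow> real. \<forall>A>0.
      \<forall>(smul :: complex \<Rightarrow> 'a \<Rightarrow> 'a) V ip0 ip1 H0 H1 C \<epsilon>.
        operator_pair smul V ip0 ip1 H0 H1 C \<longrightarrow>
        form_core ip0 H0 C \<longrightarrow> form_core ip1 H1 C \<longrightarrow>
        0 < \<epsilon> \<longrightarrow> \<epsilon> < 1 / 2 \<longrightarrow> eps_close ip0 ip1 H0 H1 C \<epsilon> \<longrightarrow>
        (\<forall>\<mu> \<in> real_spectrum smul V ip1 H1 \<inter> {0..A}.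
           real_spectrum smul V ip0 H0 \<noteq> {} \<and>
           infdist \<mu> (real_spectrum smul V ip0 H0) < c A * \<epsilon> powr (1 / 3))"
  proof (rule exI[of _ c], intro allI impI ballI)
    fix A :: real and smul :: "complex \<Rightarrow> 'a \<Rightarrow> 'a" and V ip0 ip1 H0 H1 C and \<epsilon> \<mu> :: real
    let ?S0 = "real_spectrum smul V ip0 H0" and ?S1 = "real_spectrum smul V ip1 H1"
    assume A: "0 < A" and pair: "operator_pair smul V ip0 ip1 H0 H1 C"
      and core: "form_core ip0 H0 C" "form_core ip1 H1 C"
      and \<epsilon>: "0 < \<epsilon>" "\<epsilon> < 1 / 2" and close: "eps_close ip0 ip1 H0 H1 C \<epsilon>"
      and \<mu>: "\<mu> \<in> ?S1 \<inter> {0..A}"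
    obtain \<beta> where \<beta>: "\<beta> \<in> ?S0" "\<bar>\<beta> - \<mu>\<bar> \<le> 1000 * (1 + \<mu>) ^ 4 * \<epsilon>"
      using eps_close_spectrum_near(1)[OF pair core \<epsilon>(2) close, of \<mu>] \<mu> by blast
    have "infdist \<mu> ?S0 \<le> \<bar>\<beta> - \<mu>\<bar>"
      using infdist_le[OF \<beta>(1), of \<mu>] by (simp add: dist_real_def abs_minus_commute)
    also have "\<dots> \<le> 1000 * (1 + \<mu>) ^ 4 * \<epsilon>" by (rule \<beta>(2))
    also have "\<dots> \<le> 1000 * (1 + A) ^ 4 * \<epsilon> powr (1 / 3)"
      using \<mu> \<epsilon> powr_mono'[of "1 / 3" 1 \<epsilon>] by (intro mult_mono power_mono) auto
    also have "\<dots> < c A * \<epsilon> powr (1 / 3)"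
      unfolding c_def using A \<epsilon> by (intro mult_strict_right_mono) auto
    finally show "?S0 \<noteq> {} \<and> infdist \<mu> ?S0 < c A * \<epsilon> powr (1 / 3)" using \<beta>(1) by blast
  qed
next
  define \<omega> :: "real \<Rightarrow> real" where "\<omega> = (\<lambda>\<epsilon>. (4000 * \<epsilon>) powr (1 / 5))"
  have "(\<omega> \<longlongrightarrow> 0) (at_right 0)"
  proof -
    have "((\<lambda>\<epsilon>. (4000 * \<epsilon>) powr (1 / 5)) \<longlongrightarrow> (4000 * 0) powr (1 / 5)) (at_right (0::real))"
      by (intro tendsto_powr2 tendsto_intros) (auto simp: eventually_at_right_less eventually_at_filter)
    then show ?thesis by (simp add: \<omega>_def)
  qed
  moreover have "pointed_GH_dist (pointed_spectrum (real_spectrum smul V ip0 H0))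
      (pointed_spectrum (real_spectrum smul V ip1 H1)) \<le> \<omega> \<epsilon>"
    if pair: "operator_pair smul V ip0 ip1 H0 H1 C"
      and core: "form_core ip0 H0 C" "form_core ip1 H1 C"
      and \<epsilon>: "0 < \<epsilon>" "\<epsilon> < 1 / 2" and close: "eps_close ip0 ip1 H0 H1 C \<epsilon>"
    for smul :: "complex \<Rightarrow> 'a \<Rightarrow> 'a" and V ip0 ip1 H0 H1 C \<epsilon>
  proof -
    let ?S0 = "real_spectrum smul V ip0 H0" and ?S1 = "real_spectrum smul V ip1 H1"
    define r where "r = \<omega> \<epsilon>"
    note near = eps_close_spectrum_near[OF pair core \<epsilon>(2) close]
    have r: "0 < r" "r ^ 5 = 4000 * \<epsilon>"
      using \<epsilon> powr_realpow[of r 5] by (auto simp: r_def \<omega>_def powr_powr simp flip: powr_realpow)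
    have small: "1000 * (1 + x) ^ 4 * (2 * \<epsilon>) \<le> r / 2" if "0 \<le> x" "1 + x < 1 / r" for x
    proof -
      have "(1 + x) ^ 4 \<le> (1 / r) ^ 4" using that by (intro power_mono) auto
      then have "1000 * (1 + x) ^ 4 * (2 * \<epsilon>) \<le> 1000 * (1 / r) ^ 4 * (2 * \<epsilon>)"
        using \<epsilon> by (intro mult_right_mono mult_left_mono) auto
      also have "\<dots> = r ^ 5 / (2 * r ^ 4)" using r by (simp add: power_divide)
      also have "\<dots> = r / 2" using r(1) by (simp add: eval_nat_numeral)
      finally show ?thesis .
    qed
    show ?thesis
      unfolding pointed_spectrum_def r_def[symmetric]
    proof (rule pointed_GH_dist_le[OF r(1)])
      fix x assume x: "x \<in> {-1} \<union> ?S0" "dist (-1) x < 1 / r"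
      show "\<exists>y\<in>{-1} \<union> ?S1. dist x y \<le> r / 2"
      proof (cases "x = -1")
        case True
        then show ?thesis using r by auto
      next
        case False
        then have "x \<in> ?S0" "0 \<le> x" using x near(3) by auto
        then obtain y where "y \<in> ?S1" "\<bar>y - x\<bar> \<le> 1000 * (1 + x) ^ 4 * (2 * \<epsilon>)"
          using near(2) by blast
        moreover have "1000 * (1 + x) ^ 4 * (2 * \<epsilon>) \<le> r / 2"
          using x \<open>0 \<le> x\<close> by (intro small) (auto simp: dist_real_def)
        ultimately have "\<bar>x - y\<bar> \<le> r / 2" by linarith
        with \<open>y \<in> ?S1\<close> show ?thesis by (auto simp: dist_real_def intro!: bexI[of _ y])
      qed
    next
      fix y assume y: "y \<in> {-1} \<union> ?S1" "dist (-1) y < 1 / r"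
      show "\<exists>x\<in>{-1} \<union> ?S0. dist x y \<le> r / 2"
      proof (cases "y = -1")
        case True
        then show ?thesis using r by auto
      next
        case False
        then have "y \<in> ?S1" "0 \<le> y" using y near(4) by auto
        then obtain x where "x \<in> ?S0" "\<bar>x - y\<bar> \<le> 1000 * (1 + y) ^ 4 * \<epsilon>"
          using near(1) by blast
        moreover have "1000 * (1 + y) ^ 4 * \<epsilon> \<le> 1000 * (1 + y) ^ 4 * (2 * \<epsilon>)"
          using \<epsilon> \<open>0 \<le> y\<close> by (intro mult_left_mono) auto
        moreover have "1000 * (1 + y) ^ 4 * (2 * \<epsilon>) \<le> r / 2"
          using y \<open>0 \<le> y\<close> by (intro small) (auto simp: dist_real_def)
        ultimately have "\<bar>x - y\<bar> \<le> r / 2" by linarith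
        with \<open>x \<in> ?S0\<close> show ?thesis by (auto simp: dist_real_def intro!: bexI[of _ x])
      qed
    qed
  qed
  ultimately show "\<exists>\<omega> :: real \<Rightarrow> real. (\<omega> \<longlongrightarrow> 0) (at_right 0) \<and>
      (\<forall>(smul :: complex \<Rightarrow> 'a \<Rightarrow> 'a) V ip0 ip1 H0 H1 C \<epsilon>.
        operator_pair smul V ip0 ip1 H0 H1 C \<longrightarrow>
        form_core ip0 H0 C \<longrightarrow> form_core ip1 H1 C \<longrightarrow>
        0 < \<epsilon> \<longrightarrow> \<epsilon> < 1 / 2 \<longrightarrow> eps_close ip0 ip1 H0 H1 C \<epsilon> \<longrightarrow>
        pointed_GH_dist (pointed_spectrum (real_spectrum smul V ip0 H0))
                        (pointed_spectrum (real_spectrum smul V ip1 H1)) \<le> \<omega> \<epsilon>)"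
    by blast
qed

end
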